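(* Let $\mathcal{F}$ be a $p$-dimensional foliation of the $n$-manifold $M$ and let $K\subset M$ be a closed subset such that there exists a foliation chart neighborhood for $\mathcal{F}$, which we identify with $\mathbb{R}^p\times\mathbb{R}^{n-p}$ with the standard $p$-dimensional foliation (by the leaves $\mathbb{R}^p\times\{y\}$), so that the following conditions hold: (i) $(0,0)\in K$. (ii) There exists a compact neighborhood $U$ of $0$ in $\mathbb{R}^p$ with smooth boundary $\partial U$ such that $(\partial U\times\{0\})\cap K=\varnothing$. (iii) There exists a sequence $(y_i)$ in $\mathbb{R}^{n-p}$ converging to $0$ such that $(U\times\{y_i\})\cap K=\varnothing$ for all $i$. Then $\dim H^p(\mathcal{F}_K)=\infty$, where $\mathcal{F}_K$ is the foliation induced by $\mathcal{F}$ on $M\setminus K$.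
   Context: All manifolds are smooth and all foliations are leafwise smooth, i.e. the leaves are smoothly immersed into the manifold; transversely the foliation is of class $C^r$ for some fixed $0\le r\le\infty$. $H^*(\mathcal{F})$ denotes foliated (leafwise) de Rham cohomology: the cohomology of the complex of real-valued leafwise differential forms (sections of the exterior powers of the dual of the tangent bundle of $\mathcal{F}$) which are leafwise smooth and which together with all their leafwise derivatives are transversely $C^r$, with the leafwise exterior derivative. Dimension means dimension as a real vector space. In (ii), $U$ is the same set as in (iii). *)

theory Defs
  imports "HOL-Analysis.Analysis"
begin

section \<open>Differentiability on open subsets of Euclidean space\<close>

text \<open>
  The space \<open>\<real>\<^sup>n\<close> is \<^term>\<open>Euclidean_space n\<close>, i.e. the functions \<^typ>\<open>nat \<Rightarrow> real\<close>
  vanishing at all indices \<open>\<ge> n\<close>. In this way dimensions are natural numbers and may be \<open>0\<close>.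
  If \<open>x\<close> lies in an open \<open>W \<subseteq> \<real>\<^sup>n\<close> and \<open>i < n\<close>, the partial derivative below depends only on
  the restriction of the function to \<open>W\<close>.
\<close>

definition partial :: "nat \<Rightarrow> ((nat \<Rightarrow> real) \<Rightarrow> real) \<Rightarrow> (nat \<Rightarrow> real) \<Rightarrow> real" where
  "partial i f x = deriv (\<lambda>t. f (x(i := t))) (x i)"

text \<open>The head of the list is the differentiation that is carried out last.\<close>

fun iter_partial :: "nat list \<Rightarrow> ((nat \<Rightarrow> real) \<Rightarrow> real) \<Rightarrow> (nat \<Rightarrow> real) \<Rightarrow> real" where
  "iter_partial [] f = f"
| "iter_partial (i # is) f = partial i (iter_partial is f)"

text \<open>The iterated partial derivative (and all those it is built from) exists on \<open>W\<close> and is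
  continuous there.\<close>

fun has_cont_partial :: "(nat \<Rightarrow> real) set \<Rightarrow> nat list \<Rightarrow> ((nat \<Rightarrow> real) \<Rightarrow> real) \<Rightarrow> bool" where
  "has_cont_partial W [] f \<longleftrightarrow> continuous_on W f"
| "has_cont_partial W (i # is) f \<longleftrightarrow>
     has_cont_partial W is f \<and>
     (\<forall>x\<in>W. (\<lambda>t. iter_partial is f (x(i := t))) differentiable (at (x i))) \<and>
     continuous_on W (iter_partial (i # is) f)"

definition Ck_on :: "nat \<Rightarrow> enat \<Rightarrow> (nat \<Rightarrow> real) set \<Rightarrow> ((nat \<Rightarrow> real) \<Rightarrow> real) \<Rightarrow> bool" where
  "Ck_on n k W f \<longleftrightarrow>
     (\<forall>is. set is \<subseteq> {..<n} \<and> enat (length is) \<le> k \<longrightarrow> has_cont_partial W is f)"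

text \<open>
  In \<open>\<real>\<^sup>n = \<real>\<^sup>p \<times> \<real>\<^sup>n\<^sup>-\<^sup>p\<close> the coordinates with index \<open>< p\<close> are the leaf coordinates, the other ones
  are transverse. A function is of the class below if it is leafwise smooth and if all its leafwise
  derivatives (indices \<open>as\<close>, taken first) are transversely \<open>C\<^sup>r\<close> (indices \<open>bs\<close>).
\<close>

definition leafwise_smooth_on ::
  "nat \<Rightarrow> nat \<Rightarrow> enat \<Rightarrow> (nat \<Rightarrow> real) set \<Rightarrow> ((nat \<Rightarrow> real) \<Rightarrow> real) \<Rightarrow> bool" where
  "leafwise_smooth_on p n r W f \<longleftrightarrow>
     (\<forall>as bs. set as \<subseteq> {..<p} \<and> set bs \<subseteq> {p..<n} \<and> enat (length bs) \<le> r
        \<longrightarrow> has_cont_partial W (bs @ as) f)"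

definition pair_point :: "nat \<Rightarrow> (nat \<Rightarrow> real) \<Rightarrow> (nat \<Rightarrow> real) \<Rightarrow> nat \<Rightarrow> real" where
  "pair_point p x y = (\<lambda>i. if i < p then x i else y (i - p))"

text \<open>A compact neighbourhood of the origin of \<open>\<real>\<^sup>p\<close> with smooth boundary: near each boundary point
  it is a sublevel set of a smooth function without critical point there.\<close>

definition smooth_compact_nbhd :: "nat \<Rightarrow> (nat \<Rightarrow> real) set \<Rightarrow> bool" where
  "smooth_compact_nbhd p U \<longleftrightarrow>
     compactin (Euclidean_space p) U \<and>
     (\<lambda>_. 0) \<in> Euclidean_space p interior_of U \<and>
     (\<forall>b \<in> Euclidean_space p frontier_of U.
        \<exists>W \<rho>. openin (Euclidean_space p) W \<and> b \<in> W \<and> Ck_on p \<infinity> W \<rho> \<and>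
              (\<exists>i<p. partial i \<rho> b \<noteq> 0) \<and> U \<inter> W = {x \<in> W. \<rho> x \<le> 0})"


section \<open>Smooth manifolds and foliations\<close>

text \<open>A chart consists of its domain and its coordinate map; only the values of the map on the domain
  are relevant.\<close>

type_synonym 'a chart = "'a set \<times> ('a \<Rightarrow> nat \<Rightarrow> real)"

definition chart_on :: "nat \<Rightarrow> 'a topology \<Rightarrow> 'a chart \<Rightarrow> bool" where
  "chart_on n M c \<longleftrightarrow>
     openin M (fst c) \<and> openin (Euclidean_space n) (snd c ` fst c) \<and>
     homeomorphic_map (subtopology M (fst c)) (subtopology (Euclidean_space n) (snd c ` fst c)) (snd c)"

definition chart_inv :: "'a chart \<Rightarrow> (nat \<Rightarrow> real) \<Rightarrow> 'a" where
  "chart_inv c = inv_into (fst c) (snd c)"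

definition overlap :: "'a chart \<Rightarrow> 'a chart \<Rightarrow> (nat \<Rightarrow> real) set" where
  "overlap c d = snd c ` (fst c \<inter> fst d)"

definition transition :: "'a chart \<Rightarrow> 'a chart \<Rightarrow> (nat \<Rightarrow> real) \<Rightarrow> nat \<Rightarrow> real" where
  "transition c d z = snd d (chart_inv c z)"

definition smooth_manifold :: "nat \<Rightarrow> 'a topology \<Rightarrow> 'a chart set \<Rightarrow> bool" where
  "smooth_manifold n M A \<longleftrightarrow>
     Hausdorff_space M \<and> second_countable M \<and>
     (\<forall>c\<in>A. chart_on n M c) \<and> \<Union> (fst ` A) = topspace M \<and>
     (\<forall>c\<in>A. \<forall>d\<in>A. \<forall>i<n. Ck_on n \<infinity> (overlap c d) (\<lambda>z. transition c d z i))"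

text \<open>
  Admissible charts for a foliation of transverse class \<open>C\<^sup>r\<close> on the smooth manifold given by the
  atlas \<open>A\<close>: the plaques are smoothly immersed (with all leafwise derivatives of the parametrisation
  transversely \<open>C\<^sup>r\<close>), and the chart itself is of class \<open>C\<^sup>r\<close>.
\<close>

definition admissible_chart ::
  "nat \<Rightarrow> nat \<Rightarrow> enat \<Rightarrow> 'a topology \<Rightarrow> 'a chart set \<Rightarrow> 'a chart \<Rightarrow> bool" where
  "admissible_chart p n r M A c \<longleftrightarrow>
     chart_on n M c \<and>
     (\<forall>s\<in>A.
        (\<forall>i<n. leafwise_smooth_on p n r (overlap c s) (\<lambda>z. transition c s z i)) \<and>
        (\<forall>z\<in>overlap c s. \<forall>v. 
           (\<forall>i<n. (\<Sum>j<p. v j * partial j (\<lambda>w. transition c s w i) z) = 0) \<longrightarrow> (\<forall>j<p. v j = (0::real))) \<and>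
        (\<forall>i<n. Ck_on n r (overlap s c) (\<lambda>z. transition s c z i)))"

text \<open>The transition map has locally the form \<open>(x, y) \<mapsto> (f(x, y), g(y))\<close>.\<close>

definition foliated_transition :: "nat \<Rightarrow> nat \<Rightarrow> enat \<Rightarrow> 'a chart \<Rightarrow> 'a chart \<Rightarrow> bool" where
  "foliated_transition p n r c d \<longleftrightarrow>
     (\<forall>i<n. leafwise_smooth_on p n r (overlap c d) (\<lambda>z. transition c d z i)) \<and>
     (\<forall>z\<in>overlap c d. \<exists>W. openin (Euclidean_space n) W \<and> z \<in> W \<and> W \<subseteq> overlap c d \<and>
        (\<forall>u\<in>W. \<forall>w\<in>W. (\<forall>i\<in>{p..<n}. u i = w i)
            \<longrightarrow> (\<forall>i\<in>{p..<n}. transition c d u i = transition c d w i)))"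

definition foliated_atlas ::
  "nat \<Rightarrow> nat \<Rightarrow> enat \<Rightarrow> 'a topology \<Rightarrow> 'a chart set \<Rightarrow> 'a chart set \<Rightarrow> bool" where
  "foliated_atlas p n r M A F \<longleftrightarrow>
     p \<le> n \<and> (\<forall>c\<in>F. admissible_chart p n r M A c) \<and> \<Union> (fst ` F) = topspace M \<and>
     (\<forall>c\<in>F. \<forall>d\<in>F. foliated_transition p n r c d)"

text \<open>A foliation is a maximal foliated atlas, so that its elements are precisely its foliation
  charts.\<close>

definition foliation ::
  "nat \<Rightarrow> nat \<Rightarrow> enat \<Rightarrow> 'a topology \<Rightarrow> 'a chart set \<Rightarrow> 'a chart set \<Rightarrow> bool" where
  "foliation p n r M A F \<longleftrightarrow>
     foliated_atlas p n r M A F \<and>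
     (\<forall>F'. foliated_atlas p n r M A F' \<and> F \<subseteq> F' \<longrightarrow> F' = F)"

text \<open>The foliation induced on an open subset; as \<open>F\<close> is maximal, this is again maximal.\<close>

definition induced_foliation :: "'a chart set \<Rightarrow> 'a set \<Rightarrow> 'a chart set" where
  "induced_foliation F X = {c \<in> F. fst c \<subseteq> X}"


section \<open>Leafwise differential forms\<close>

text \<open>
  A vector at \<open>x\<close> tangent to the foliation is given by its coordinate vectors in \<open>\<real>\<^sup>p\<close> with respect
  to all foliation charts around \<open>x\<close>, which transform by the leafwise Jacobians.
\<close>

type_synonym 'a tangent = "'a chart \<Rightarrow> nat \<Rightarrow> real"

definition leaf_tangent_space :: "nat \<Rightarrow> 'a chart set \<Rightarrow> 'a \<Rightarrow> 'a tangent set" where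
  "leaf_tangent_space p F x = {v.
     (\<forall>c i. c \<notin> F \<or> x \<notin> fst c \<or> p \<le> i \<longrightarrow> v c i = 0) \<and>
     (\<forall>c\<in>F. \<forall>d\<in>F. x \<in> fst c \<and> x \<in> fst d \<longrightarrow>
        (\<forall>j<p. v d j = (\<Sum>i<p. partial i (\<lambda>z. transition c d z j) (snd c x) * v c i)))}"

definition coord_vector :: "nat \<Rightarrow> 'a chart set \<Rightarrow> 'a chart \<Rightarrow> 'a \<Rightarrow> nat \<Rightarrow> 'a tangent" where
  "coord_vector p F c x i = (\<lambda>d j.
     if d \<in> F \<and> x \<in> fst d \<and> j < p then partial i (\<lambda>z. transition c d z j) (snd c x) else 0)"

type_synonym 'a form = "'a \<Rightarrow> 'a tangent list \<Rightarrow> real"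

text \<open>Alternating \<open>k\<close>-linear functions on the tangent spaces, extended by \<open>0\<close> to all other arguments.\<close>

definition alternating_form :: "nat \<Rightarrow> 'a chart set \<Rightarrow> nat \<Rightarrow> 'a form \<Rightarrow> bool" where
  "alternating_form p F k \<omega> \<longleftrightarrow>
     (\<forall>x vs. \<not> (x \<in> \<Union> (fst ` F) \<and> length vs = k \<and> set vs \<subseteq> leaf_tangent_space p F x) \<longrightarrow> \<omega> x vs = 0) \<and>
     (\<forall>x \<in> \<Union> (fst ` F). \<forall>vs. length vs = k \<and> set vs \<subseteq> leaf_tangent_space p F x \<longrightarrow>
        (\<forall>l<k. \<forall>u \<in> leaf_tangent_space p F x. \<forall>w \<in> leaf_tangent_space p F x. \<forall>a b.
           \<omega> x (vs[l := (\<lambda>c i. a * u c i + b * w c i)]) = a * \<omega> x (vs[l := u]) + b * \<omega> x (vs[l := w])) \<and>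
        (\<forall>l m. l < m \<and> m < k \<and> vs ! l = vs ! m \<longrightarrow> \<omega> x vs = 0))"

definition form_coeff ::
  "nat \<Rightarrow> 'a chart set \<Rightarrow> 'a form \<Rightarrow> 'a chart \<Rightarrow> nat list \<Rightarrow> (nat \<Rightarrow> real) \<Rightarrow> real" where
  "form_coeff p F \<omega> c is z = \<omega> (chart_inv c z) (map (coord_vector p F c (chart_inv c z)) is)"

definition leafwise_forms :: "nat \<Rightarrow> nat \<Rightarrow> enat \<Rightarrow> 'a chart set \<Rightarrow> nat \<Rightarrow> 'a form set" where
  "leafwise_forms p n r F k = {\<omega>. alternating_form p F k \<omega> \<and>
     (\<forall>c\<in>F. \<forall>is. length is = k \<and> set is \<subseteq> {..<p} \<longrightarrow>
        leafwise_smooth_on p n r (snd c ` fst c) (form_coeff p F \<omega> c is))}"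

text \<open>
  \<open>\<eta>\<close> is the leafwise exterior derivative of the \<open>k\<close>-form \<open>\<omega>\<close>: for \<open>i\<^sub>0 < \<dots> < i\<^sub>k\<close>, in each chart
  \<open>\<eta>(i\<^sub>0, \<dots>, i\<^sub>k) = \<Sum>\<^sub>l (-1)\<^sup>l \<partial>\<omega>(i\<^sub>0, \<dots>, i\<^sub>l omitted, \<dots>, i\<^sub>k) / \<partial>x(i\<^sub>l)\<close>.
\<close>

definition has_leafwise_d ::
  "nat \<Rightarrow> 'a chart set \<Rightarrow> nat \<Rightarrow> 'a form \<Rightarrow> 'a form \<Rightarrow> bool" where
  "has_leafwise_d p F k \<omega> \<eta> \<longleftrightarrow>
     (\<forall>c\<in>F. \<forall>is. length is = Suc k \<and> set is \<subseteq> {..<p} \<and> sorted_wrt (<) is \<longrightarrow>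
        (\<forall>z \<in> snd c ` fst c.
           form_coeff p F \<eta> c is z =
             (\<Sum>l\<le>k. (-1) ^ l * partial (is ! l) (form_coeff p F \<omega> c (take l is @ drop (Suc l) is)) z)))"


section \<open>Leafwise cohomology\<close>

definition closed_forms :: "nat \<Rightarrow> nat \<Rightarrow> enat \<Rightarrow> 'a chart set \<Rightarrow> nat \<Rightarrow> 'a form set" where
  "closed_forms p n r F k = {\<omega> \<in> leafwise_forms p n r F k. has_leafwise_d p F k \<omega> (\<lambda>_ _. 0)}"

definition exact_forms :: "nat \<Rightarrow> nat \<Rightarrow> enat \<Rightarrow> 'a chart set \<Rightarrow> nat \<Rightarrow> 'a form set" where
  "exact_forms p n r F k =
     (case k of
        0 \<Rightarrow> {\<lambda>_ _. 0}
      | Suc m \<Rightarrow> {\<eta> \<in> leafwise_forms p n r F k. \<exists>\<alpha> \<in> leafwise_forms p n r F m. has_leafwise_d p F m \<alpha> \<eta>})"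

text \<open>\<open>S\<close> represents a linearly independent family in the quotient by the linear subspace \<open>B\<close>.\<close>

definition independent_mod :: "'a form set \<Rightarrow> 'a form set \<Rightarrow> bool" where
  "independent_mod B S \<longleftrightarrow>
     (\<forall>a. (\<lambda>x vs. \<Sum>\<omega>\<in>S. a \<omega> * \<omega> x vs) \<in> B \<longrightarrow> (\<forall>\<omega>\<in>S. a \<omega> = (0::real)))"

text \<open>The dimension of the real vector space of closed modulo exact leafwise \<open>k\<close>-forms.\<close>

definition leafwise_cohomology_dim :: "nat \<Rightarrow> nat \<Rightarrow> enat \<Rightarrow> 'a chart set \<Rightarrow> nat \<Rightarrow> enat" where
  "leafwise_cohomology_dim p n r F k =
     (SUP S \<in> {S. finite S \<and> S \<subseteq> closed_forms p n r F k \<and> independent_mod (exact_forms p n r F k) S}.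
        enat (card S))"

end

theory Submission
  imports Defs "HOL-Library.Sublist"
begin

text \<open>
  In the given chart let \<open>O \<subseteq> \<real>\<^sup>n\<close> be the complement of \<open>K\<close> and let \<open>K\<^sub>0 = {x \<in> U. (x, 0) \<notin> O}\<close>, a
  compact subset of the interior of \<open>U\<close> containing \<open>0\<close>. Choose a \<open>C\<^sup>1\<close> function \<open>\<psi>\<close> with compact
  support in the interior of \<open>U\<close> which is \<open>1\<close> near \<open>K\<^sub>0\<close>, and integrate \<open>p\<close>-forms against \<open>\<psi>\<close> over the
  slices \<open>U \<times> {y\<^sub>k} \<subseteq> O\<close>. Since \<open>d\<psi>\<close> is supported in a compact set \<open>C\<close> with
  \<open>C \<times> ({0} \<union> {y\<^sub>k | k}) \<subseteq> O\<close> compact, integration by parts bounds these integrals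
  independently of \<open>k\<close> for each exact form; using \<open>\<psi>\<close> instead of \<open>1\<close> replaces Stokes' theorem on \<open>U\<close>.
  On the other hand the forms
  \<open>h(1 - \<bar>z\<bar>\<^sup>2) \<bar>z\<bar>\<^sup>-\<^sup>2\<^sup>m dz\<^sub>1 \<and> \<dots> \<and> dz\<^sub>p\<close> with \<open>m > p\<close> and the cutoff \<open>h(t) = exp(-1/t)\<close>
  (\<open>0\<close> for \<open>t \<le> 0\<close>) extend by \<open>0\<close> to \<open>M - K\<close>, because their only singularity \<open>0\<close> lies in \<open>K\<close>, and
  any nontrivial linear combination of them has unbounded integrals as \<open>y\<^sub>k \<rightarrow> 0\<close>.
\<close>

section \<open>Coordinate space\<close>

text \<open>A primitive \<alpha> of an exact form is under control only on compact subsets of the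
  complement of \<open>K\<close>; close to \<open>K\<close> it may blow up, so the integrals of its
  derivative admit no direct estimate. Moving the derivative to \<psi> helps because d\<psi>
  vanishes wherever \<alpha> may degenerate in the limit. Only derivatives along the leaves enter,
  so all \<open>r\<close>, including 0, are treated alike. On the slice of y_k the squared norm is q
  = |x|^2 + s_k with s_k = |y_k|^2, and s_k > 0 since (0, y_k) lies outside \<open>K\<close> and (0,
  0) inside. On a box of half side s_k <= 1 one has q <= (p + 1) s_k, so the pole q^(-m) contributes
  at least a constant times s_k^(p - m), which is unbounded for m > p. Poles of different orders
  cannot cancel, because the highest order dominates near q = 0. Every p-form is closed for reasons
  of degree. What remains is to make the forms global: a determinant of tangent vectors takes care
  of the change of charts, and extension by 0 works because the closed unit ball of the chart is
  compact, hence closed in the Hausdorff space \<open>M\<close>.\<close>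

abbreviation coord_space :: "nat \<Rightarrow> (nat \<Rightarrow> real) set" where
  "coord_space n \<equiv> {x. \<forall>i\<ge>n. x i = 0}"

lemma Euclidean_space_eq: "Euclidean_space n = top_of_set (coord_space n)"
  by (simp add: Euclidean_space_def euclidean_product_topology)

lemma openin_Euclidean_space_subset: "openin (Euclidean_space n) W \<Longrightarrow> W \<subseteq> coord_space n"
  using openin_subset topspace_Euclidean_space by blast

lemma continuous_on_update: "continuous_on T (\<lambda>t. (x :: nat \<Rightarrow> real)(i := t))"
proof (rule continuous_on_coordinatewise_then_product)
  show "continuous_on T (\<lambda>t. (x(i := t)) j)" for j
    by (cases "j = i") (auto intro: continuous_intros)
qed

lemma open_update_line:
  assumes "openin (Euclidean_space n) W" "i < n" "x \<in> coord_space n"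
  shows "open {t. x(i := t) \<in> W}"
proof -
  obtain T where T: "open T" "W = coord_space n \<inter> T"
    using assms(1) by (auto simp: Euclidean_space_eq openin_open)
  have "{t. x(i := t) \<in> W} = (\<lambda>t. x(i := t)) -` T"
    using assms(2,3) by (auto simp: T(2))
  then show ?thesis
    using open_vimage[OF T(1) continuous_on_update] by simp
qed

lemma eventually_update_in:
  assumes "openin (Euclidean_space n) W" "i < n" "x \<in> W"
  shows "eventually (\<lambda>t. x(i := t) \<in> W) (nhds (x i))"
proof -
  have "open {t. x(i := t) \<in> W}"
    using open_update_line assms openin_Euclidean_space_subset by blast
  then show ?thesis
    using eventually_nhds_in_open[of "{t. x(i := t) \<in> W}" "x i"] assms(3) by simp
qed

text \<open>A basic open set of the product topology restricts each coordinate separately, and the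
  coordinates from \<open>n\<close> on are 0 for both points; so finitely many bounds suffice, and
  their minimum is a uniform one.\<close>

lemma Euclidean_space_box_nhd:
  assumes "openin (Euclidean_space n) W" "a \<in> W"
  obtains e where "e > 0" "\<And>x. x \<in> coord_space n \<Longrightarrow> (\<And>j. j < n \<Longrightarrow> \<bar>x j - a j\<bar> < e) \<Longrightarrow> x \<in> W"
proof -
  obtain T where T: "open T" "W = coord_space n \<inter> T"
    using assms(1) by (auto simp: Euclidean_space_eq openin_open)
  have "openin (product_topology (\<lambda>i. euclidean) UNIV) T" "a \<in> T"
    using T assms(2) by (auto simp: euclidean_product_topology)
  then obtain B where B: "a \<in> Pi\<^sub>E UNIV B" "\<And>i. open (B i)" "Pi\<^sub>E UNIV B \<subseteq> T"
    using product_topology_open_contains_basis[of "\<lambda>i. euclidean" UNIV T a] by auto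
  have "\<exists>e>0. \<forall>t. \<bar>t - a i\<bar> < e \<longrightarrow> t \<in> B i" for i
  proof -
    have "a i \<in> B i"
      using B(1) by auto
    with B(2) obtain e where "e > 0" "ball (a i) e \<subseteq> B i"
      using open_contains_ball by blast
    then show ?thesis
      by (intro exI[of _ e]) (auto simp: dist_real_def abs_minus_commute subset_eq)
  qed
  then obtain e where e: "\<And>i. e i > 0" "\<And>i t. \<bar>t - a i\<bar> < e i \<Longrightarrow> t \<in> B i"
    by metis
  \<comment> \<open>The inserted 1 keeps the minimum meaningful for \<open>n = 0\<close>.\<close>
  define d where "d = Min (insert 1 (e ` {..<n}))"
  have "d > 0"
    using e(1) by (auto simp: d_def)
  moreover have "x \<in> W" if x: "x \<in> coord_space n" "\<And>j. j < n \<Longrightarrow> \<bar>x j - a j\<bar> < d" for x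
  proof -
    have "x j \<in> B j" for j
    proof (cases "j < n")
      case True
      then have "d \<le> e j"
        by (auto simp: d_def)
      then show ?thesis
        using x(2)[OF True] e(2) by fastforce
    next
      case False
      then have "x j = a j"
        using x(1) assms(2) T(2) by auto
      then show ?thesis
        using e(2) e(1) by simp
    qed
    then show ?thesis
      using B(3) x(1) T(2) by auto
  qed
  ultimately show thesis
    using that by blast
qed

section \<open>Functions with continuous mixed partial derivatives\<close>

lemma partial_cong:
  assumes "openin (Euclidean_space n) W" "i < n" "x \<in> W" "\<And>w. w \<in> W \<Longrightarrow> f w = g w"
  shows "partial i f x = partial i g x"
  unfolding partial_def
  using eventually_update_in[OF assms(1-3)]
  by (intro deriv_cong_ev) (auto elim!: eventually_mono simp: assms(4))

lemma differentiable_line_cong: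
  fixes f g :: "(nat \<Rightarrow> real) \<Rightarrow> real"
  assumes "openin (Euclidean_space n) W" "i < n" "x \<in> W" "\<And>w. w \<in> W \<Longrightarrow> f w = g w"
  shows "(\<lambda>t. f (x(i := t))) differentiable (at (x i)) \<longleftrightarrow> (\<lambda>t. g (x(i := t))) differentiable (at (x i))"
proof -
  have "((\<lambda>t. f (x(i := t))) has_real_derivative D) (at (x i)) \<longleftrightarrow>
        ((\<lambda>t. g (x(i := t))) has_real_derivative D) (at (x i))" for D
    using eventually_update_in[OF assms(1-3)]
    by (intro DERIV_cong_ev) (auto elim!: eventually_mono simp: assms(4))
  then show ?thesis
    by (simp add: real_differentiable_def)
qed

lemma DERIV_partial:
  assumes "(\<lambda>t. f (x(i := t))) differentiable (at (x i))"
  shows "((\<lambda>t. f (x(i := t))) has_real_derivative partial i f x) (at (x i))"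
  unfolding partial_def using assms by (simp add: DERIV_deriv_iff_real_differentiable)

lemma partial_eqI:
  "((\<lambda>t. f (x(i := t))) has_real_derivative D) (at (x i)) \<Longrightarrow> partial i f x = D"
  unfolding partial_def by (rule DERIV_imp_deriv)

text \<open>Unlike in \<^const>\<open>has_cont_partial\<close>, the head of the list is differentiated first here, and the
  derivatives along all subsequences of the list are required as well; this makes the closure
  properties below provable by induction.\<close>

fun regular_along :: "(nat \<Rightarrow> real) set \<Rightarrow> nat list \<Rightarrow> ((nat \<Rightarrow> real) \<Rightarrow> real) \<Rightarrow> bool" where
  "regular_along W [] f \<longleftrightarrow> continuous_on W f"
| "regular_along W (i # is) f \<longleftrightarrow> regular_along W is f \<and>
     (\<forall>x\<in>W. (\<lambda>t. f (x(i := t))) differentiable (at (x i))) \<and> regular_along W is (partial i f)"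

section \<open>Equivalence of the two notions of regularity\<close>

lemma iter_partial_append: "iter_partial (is @ js) f = iter_partial is (iter_partial js f)"
  by (induction "is") auto

text \<open>The recursion of \<open>has_cont_partial\<close> exposes the derivative taken last; this
  exposes the one taken first, as \<open>regular_along\<close> does.\<close>

lemma has_cont_partial_snoc:
  "has_cont_partial W (is @ [i]) f \<longleftrightarrow> continuous_on W f \<and>
     (\<forall>x\<in>W. (\<lambda>t. f (x(i := t))) differentiable (at (x i))) \<and> has_cont_partial W is (partial i f)"
proof (induction "is")
  case Nil
  show ?case by (simp del: fun_upd_apply)
next
  case (Cons a "is")
  then show ?case by (auto simp: iter_partial_append simp del: fun_upd_apply)
qed

lemma regular_along_continuous: "regular_along W is f \<Longrightarrow> continuous_on W f"
  by (induction "is" arbitrary: f) auto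

lemma regular_along_imp_has_cont_partial: "regular_along W is f \<Longrightarrow> has_cont_partial W (rev is) f"
  by (induction "is" arbitrary: f) (auto simp: has_cont_partial_snoc dest: regular_along_continuous)

text \<open>Subsequences appear because \<open>regular_along W (i # is) f\<close> also asks for
  \<open>regular_along W is f\<close>, which skips the derivative along \<open>i\<close>.\<close>

lemma has_cont_partial_imp_regular_along:
  "(\<And>js. subseq js is \<Longrightarrow> has_cont_partial W (rev js) f) \<Longrightarrow> regular_along W is f"
proof (induction "is" arbitrary: f)
  case Nil
  from Nil[of "[]"] show ?case by simp
next
  case (Cons i "is")
  have *: "has_cont_partial W (rev js @ [i]) f" if "subseq js is" for js
    using Cons.prems[of "i # js"] that by simp
  have "regular_along W is f"
    by (rule Cons.IH) (rule Cons.prems, auto)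
  moreover have "regular_along W is (partial i f)"
    by (rule Cons.IH) (use * has_cont_partial_snoc in blast)
  ultimately show ?case
    using *[of "[]"] by simp
qed

text \<open>The class is stable under passing to subsequences of \<open>as\<close> and
  \<open>bs\<close>, since this never raises the transverse order; hence the stronger notion costs
  nothing. The lists trade places because the two notions read them in opposite directions: leafwise
  derivatives come first in both.\<close>

lemma leafwise_smooth_on_iff:
  "leafwise_smooth_on p n r W f \<longleftrightarrow>
     (\<forall>as bs. set as \<subseteq> {..<p} \<and> set bs \<subseteq> {p..<n} \<and> enat (length bs) \<le> r \<longrightarrow> regular_along W (as @ bs) f)"
    (is "?L \<longleftrightarrow> ?R")
proof
  assume L: ?L
  show ?R
  proof (intro allI impI has_cont_partial_imp_regular_along)
    fix as bs js
    assume *: "set as \<subseteq> {..<p} \<and> set bs \<subseteq> {p..<n} \<and> enat (length bs) \<le> r" and "subseq js (as @ bs)"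
    then obtain as' bs' where js: "js = as' @ bs'" "subseq as' as" "subseq bs' bs"
      by (auto simp: subseq_append_iff)
    have "length bs' \<le> length bs"
      using js(3) list_emb_length by blast
    then have "enat (length bs') \<le> r"
      using * by (meson dual_order.trans enat_ord_simps(1))
    moreover have "set as' \<subseteq> set as" "set bs' \<subseteq> set bs"
      using js by (auto elim: list_emb_set)
    ultimately have "has_cont_partial W (rev bs' @ rev as') f"
      using L * unfolding leafwise_smooth_on_def by (metis length_rev order_trans set_rev)
    then show "has_cont_partial W (rev js) f"
      by (simp add: js)
  qed
next
  assume R: ?R
  show ?L
    unfolding leafwise_smooth_on_def
  proof (intro allI impI)
    fix as bs
    assume *: "set as \<subseteq> {..<p} \<and> set bs \<subseteq> {p..<n} \<and> enat (length bs) \<le> r"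
    then have "regular_along W (rev as @ rev bs) f"
      using R[rule_format, of "rev as" "rev bs"] by simp
    from regular_along_imp_has_cont_partial[OF this] show "has_cont_partial W (bs @ as) f"
      by simp
  qed
qed

section \<open>Locality of regularity\<close>

lemma regular_along_cong:
  assumes "openin (Euclidean_space n) W" "\<And>w. w \<in> W \<Longrightarrow> f w = g w" "set is \<subseteq> {..<n}"
  shows "regular_along W is f \<longleftrightarrow> regular_along W is g"
  using assms(2,3)
proof (induction "is" arbitrary: f g)
  case Nil
  then show ?case by (simp cong: continuous_on_cong)
next
  case (Cons i "is")
  have "regular_along W is f \<longleftrightarrow> regular_along W is g"
    by (rule Cons.IH) (use Cons.prems in auto)
  moreover have "regular_along W is (partial i f) \<longleftrightarrow> regular_along W is (partial i g)"
  proof (rule Cons.IH)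
    show "partial i f w = partial i g w" if "w \<in> W" for w
      by (rule partial_cong[OF assms(1) _ that Cons.prems(1)]) (use Cons.prems(2) in auto)
  qed (use Cons.prems in auto)
  moreover have "(\<lambda>t. f (x(i := t))) differentiable (at (x i)) \<longleftrightarrow>
      (\<lambda>t. g (x(i := t))) differentiable (at (x i))" if "x \<in> W" for x
    by (rule differentiable_line_cong[OF assms(1) _ that Cons.prems(1)]) (use Cons.prems(2) in auto)
  ultimately show ?case
    by simp
qed

lemma regular_along_subset: "regular_along W is f \<Longrightarrow> W' \<subseteq> W \<Longrightarrow> regular_along W' is f"
proof (induction "is" arbitrary: f)
  case Nil
  then show ?case using continuous_on_subset by auto
qed auto

lemma continuous_on_openin_local:
  fixes W :: "'a::t2_space set"
  assumes "W \<subseteq> S" "\<And>x. x \<in> W \<Longrightarrow> \<exists>W'. openin (top_of_set S) W' \<and> x \<in> W' \<and> continuous_on W' f"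
  shows "continuous_on W f"
  unfolding continuous_on_eq_continuous_within
proof
  fix x assume "x \<in> W"
  then obtain W' where W': "openin (top_of_set S) W'" "x \<in> W'" "continuous_on W' f"
    using assms(2) by blast
  obtain T where T: "open T" "W' = S \<inter> T"
    using W'(1) by (auto simp: openin_open)
  have "continuous (at x within W \<inter> T) f"
    using W'(2,3) T(2) assms(1)
    by (meson continuous_on_eq_continuous_within continuous_within_subset Int_mono order_refl)
  moreover have "at x within W \<inter> T = at x within W"
    by (rule at_within_nhd[of _ T]) (use W'(2) T in auto)
  ultimately show "continuous (at x within W) f"
    by simp
qed

lemma regular_along_local:
  assumes "W \<subseteq> coord_space n"
    and "\<And>x. x \<in> W \<Longrightarrow> \<exists>W'. openin (Euclidean_space n) W' \<and> x \<in> W' \<and> regular_along W' is f"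
  shows "regular_along W is f"
  using assms(2)
proof (induction "is" arbitrary: f)
  case Nil
  show ?case
    unfolding regular_along.simps
    by (rule continuous_on_openin_local[OF assms(1)]) (use Nil in \<open>simp add: Euclidean_space_eq\<close>)
next
  case (Cons i "is")
  have "regular_along W is f" "regular_along W is (partial i f)"
    by (rule Cons.IH, use Cons.prems in fastforce)+
  moreover have "(\<lambda>t. f (x(i := t))) differentiable (at (x i))" if "x \<in> W" for x
    using Cons.prems[OF that] by auto
  ultimately show ?case
    by simp
qed

lemma regular_along_partial:
  "regular_along W (i # is) f \<Longrightarrow> x \<in> W \<Longrightarrow>
     ((\<lambda>t. f (x(i := t))) has_real_derivative partial i f x) (at (x i))"
  by (auto intro: DERIV_partial)

section \<open>Closure under sums, products, inverses and composition\<close>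

context
  fixes n :: nat and W :: "(nat \<Rightarrow> real) set"
  assumes W: "openin (Euclidean_space n) W"
begin

text \<open>Allows an explicit formula \<open>f'\<close> in place of \<open>partial i f\<close>; the
  two are known to agree on \<open>W\<close> only, which is enough as \<open>W\<close> is
  open.\<close>

lemma regular_along_ConsI:
  assumes "regular_along W is f" "i < n" "set is \<subseteq> {..<n}"
    and "\<And>x. x \<in> W \<Longrightarrow> ((\<lambda>t. f (x(i := t))) has_real_derivative f' x) (at (x i))"
    and "regular_along W is f'"
  shows "regular_along W (i # is) f"
proof -
  have "regular_along W is (partial i f)"
    using regular_along_cong[OF W, of f' "partial i f" "is"] assms(3-5) partial_eqI by metis
  then show ?thesis
    using assms(1,4) by (auto simp: real_differentiable_def)
qed

lemma regular_along_const: "set is \<subseteq> {..<n} \<Longrightarrow> regular_along W is (\<lambda>_. c)"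
proof (induction "is" arbitrary: c)
  case (Cons i "is")
  show ?case
    by (rule regular_along_ConsI[where f' = "\<lambda>_. 0"]) (use Cons in auto)
qed simp

lemma regular_along_add:
  "regular_along W is f \<Longrightarrow> regular_along W is g \<Longrightarrow> set is \<subseteq> {..<n} \<Longrightarrow>
     regular_along W is (\<lambda>x. f x + g x)"
proof (induction "is" arbitrary: f g)
  case (Cons i "is")
  show ?case
  proof (rule regular_along_ConsI)
    show "((\<lambda>t. f (x(i := t)) + g (x(i := t))) has_real_derivative partial i f x + partial i g x) (at (x i))"
      if "x \<in> W" for x
      using regular_along_partial[OF Cons.prems(1) that] regular_along_partial[OF Cons.prems(2) that]
      by (rule DERIV_add)
    show "regular_along W is (\<lambda>x. partial i f x + partial i g x)"
      by (rule Cons.IH) (use Cons.prems in auto)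
  qed (use Cons in auto)
qed (auto intro: continuous_intros)

lemma regular_along_mult:
  "regular_along W is f \<Longrightarrow> regular_along W is g \<Longrightarrow> set is \<subseteq> {..<n} \<Longrightarrow>
     regular_along W is (\<lambda>x. f x * g x)"
proof (induction "is" arbitrary: f g)
  case (Cons i "is")
  show ?case
  proof (rule regular_along_ConsI)
    show "((\<lambda>t. f (x(i := t)) * g (x(i := t))) has_real_derivative
             partial i f x * g x + partial i g x * f x) (at (x i))"
      if "x \<in> W" for x
      using DERIV_mult[OF regular_along_partial[OF Cons.prems(1) that] regular_along_partial[OF Cons.prems(2) that]]
      by (simp del: fun_upd_apply)
    show "regular_along W is (\<lambda>x. partial i f x * g x + partial i g x * f x)"
      by (intro regular_along_add Cons.IH) (use Cons.prems in auto)
  qed (use Cons in auto)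
qed (auto intro: continuous_intros)

text \<open>The derivative of the inverse contains, besides \<open>partial i f\<close>, only the
  inverse itself, which the induction covers for the shorter list.\<close>

lemma regular_along_inverse:
  "regular_along W is f \<Longrightarrow> (\<And>x. x \<in> W \<Longrightarrow> f x \<noteq> 0) \<Longrightarrow> set is \<subseteq> {..<n} \<Longrightarrow>
     regular_along W is (\<lambda>x. inverse (f x))"
proof (induction "is" arbitrary: f)
  case (Cons i "is")
  have inv: "regular_along W is (\<lambda>x. inverse (f x))"
    using Cons by auto
  show ?case
  proof (rule regular_along_ConsI)
    show "((\<lambda>t. inverse (f (x(i := t)))) has_real_derivative
             - 1 * (partial i f x * (inverse (f x) * inverse (f x)))) (at (x i))"
      if "x \<in> W" for x
      using DERIV_inverse_fun[OF regular_along_partial[OF Cons.prems(1) that]] Cons.prems(2)[OF that]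
      by (simp add: field_simps del: fun_upd_apply)
    show "regular_along W is (\<lambda>x. - 1 * (partial i f x * (inverse (f x) * inverse (f x))))"
      by (intro regular_along_mult regular_along_const inv) (use Cons.prems in auto)
  qed (use Cons.prems inv in auto)
qed (auto intro: continuous_intros)

text \<open>The outer function comes as a whole sequence of successive derivatives, so that the
  induction can pass from \<open>D k\<close> to \<open>D (Suc k)\<close>.\<close>

lemma regular_along_compose:
  assumes "\<And>k t. (D k has_real_derivative D (Suc k) t) (at t)"
  shows "regular_along W is f \<Longrightarrow> set is \<subseteq> {..<n} \<Longrightarrow> regular_along W is (\<lambda>x. D k (f x))"
proof (induction "is" arbitrary: f k)
  case Nil
  have "continuous_on UNIV (D k)"
    using assms DERIV_isCont continuous_at_imp_continuous_on by blast
  then show ?case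
    using Nil continuous_on_compose2 by fastforce
next
  case (Cons i "is")
  show ?case
  proof (rule regular_along_ConsI)
    show "((\<lambda>t. D k (f (x(i := t)))) has_real_derivative D (Suc k) (f x) * partial i f x) (at (x i))"
      if "x \<in> W" for x
      using DERIV_chain2[OF _ regular_along_partial[OF Cons.prems(1) that], of "D k"] assms
      by (simp del: fun_upd_apply)
    show "regular_along W is (\<lambda>x. D (Suc k) (f x) * partial i f x)"
      by (intro regular_along_mult Cons.IH) (use Cons.prems in auto)
  qed (use Cons in auto)
qed

end

section \<open>Leafwise smooth functions\<close>

lemma leafwise_smooth_on_subset:
  "leafwise_smooth_on p n r W f \<Longrightarrow> W' \<subseteq> W \<Longrightarrow> leafwise_smooth_on p n r W' f"
  unfolding leafwise_smooth_on_iff using regular_along_subset by metis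

lemma leafwise_smooth_on_continuous: "leafwise_smooth_on p n r W f \<Longrightarrow> continuous_on W f"
proof -
  assume f: "leafwise_smooth_on p n r W f"
  have "regular_along W ([] @ []) f"
    by (rule f[unfolded leafwise_smooth_on_iff, rule_format]) (simp add: enat_0)
  then show ?thesis by simp
qed

lemma leafwise_smooth_on_partial:
  "leafwise_smooth_on p n r W f \<Longrightarrow> i < p \<Longrightarrow> leafwise_smooth_on p n r W (partial i f)"
  unfolding leafwise_smooth_on_iff
proof (intro allI impI)
  fix as bs
  assume f: "\<forall>as bs. set as \<subseteq> {..<p} \<and> set bs \<subseteq> {p..<n} \<and> enat (length bs) \<le> r \<longrightarrow> regular_along W (as @ bs) f"
    and "i < p" and *: "set as \<subseteq> {..<p} \<and> set bs \<subseteq> {p..<n} \<and> enat (length bs) \<le> r"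
  then have "regular_along W ((i # as) @ bs) f"
    by (intro f[rule_format]) auto
  then show "regular_along W (as @ bs) (partial i f)"
    by simp
qed

lemma leafwise_smooth_on_DERIV:
  assumes "leafwise_smooth_on p n r W f" "i < p" "x \<in> W"
  shows "((\<lambda>t. f (x(i := t))) has_real_derivative partial i f x) (at (x i))"
proof -
  have "regular_along W ([i] @ []) f"
    by (rule assms(1)[unfolded leafwise_smooth_on_iff, rule_format]) (simp add: assms(2) enat_0)
  then show ?thesis
    using regular_along_partial[of W i "[]"] assms(3) by simp
qed

text \<open>This is what permits gluing a form in a chart with the zero form outside its
  support.\<close>

lemma leafwise_smooth_on_local:
  assumes "W \<subseteq> coord_space n"
    and "\<And>x. x \<in> W \<Longrightarrow> \<exists>W'. openin (Euclidean_space n) W' \<and> x \<in> W' \<and> leafwise_smooth_on p n r W' f"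
  shows "leafwise_smooth_on p n r W f"
  unfolding leafwise_smooth_on_iff
proof (intro allI impI regular_along_local[OF assms(1)])
  fix as bs x
  assume *: "set as \<subseteq> {..<p} \<and> set bs \<subseteq> {p..<n} \<and> enat (length bs) \<le> r" and "x \<in> W"
  then obtain W' where "openin (Euclidean_space n) W'" "x \<in> W'" "leafwise_smooth_on p n r W' f"
    using assms(2) by blast
  moreover from this(3) have "regular_along W' (as @ bs) f"
    using * unfolding leafwise_smooth_on_iff by simp
  ultimately show "\<exists>W'. openin (Euclidean_space n) W' \<and> x \<in> W' \<and> regular_along W' (as @ bs) f"
    by metis
qed

context
  fixes p n :: nat and W :: "(nat \<Rightarrow> real) set"
  assumes W: "openin (Euclidean_space n) W" and pn: "p \<le> n"
begin

lemma index_bound: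
  "set as \<subseteq> {..<p} \<and> set bs \<subseteq> {p..<n} \<and> Q \<Longrightarrow> set (as @ bs) \<subseteq> {..<n}"
  using pn by fastforce

lemma leafwise_smooth_on_cong:
  assumes "\<And>w. w \<in> W \<Longrightarrow> f w = g w"
  shows "leafwise_smooth_on p n r W f \<longleftrightarrow> leafwise_smooth_on p n r W g"
  unfolding leafwise_smooth_on_iff using regular_along_cong[OF W, of f g] assms index_bound by (metis (no_types))

lemma leafwise_smooth_on_const: "leafwise_smooth_on p n r W (\<lambda>_. c)"
  unfolding leafwise_smooth_on_iff
  by (intro allI impI regular_along_const[OF W]) (use index_bound in blast)+

lemma leafwise_smooth_on_add:
  "leafwise_smooth_on p n r W f \<Longrightarrow> leafwise_smooth_on p n r W g \<Longrightarrow>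
     leafwise_smooth_on p n r W (\<lambda>x. f x + g x)"
  unfolding leafwise_smooth_on_iff
  by (intro allI impI regular_along_add[OF W]) (use index_bound in blast)+

lemma leafwise_smooth_on_mult:
  "leafwise_smooth_on p n r W f \<Longrightarrow> leafwise_smooth_on p n r W g \<Longrightarrow>
     leafwise_smooth_on p n r W (\<lambda>x. f x * g x)"
  unfolding leafwise_smooth_on_iff
  by (intro allI impI regular_along_mult[OF W]) (use index_bound in blast)+

lemma leafwise_smooth_on_inverse:
  "leafwise_smooth_on p n r W f \<Longrightarrow> (\<And>x. x \<in> W \<Longrightarrow> f x \<noteq> 0) \<Longrightarrow>
     leafwise_smooth_on p n r W (\<lambda>x. inverse (f x))"
  unfolding leafwise_smooth_on_iff
  by (intro allI impI regular_along_inverse[OF W]) (use index_bound in blast)+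

lemma leafwise_smooth_on_compose:
  "(\<And>k t. (D k has_real_derivative D (Suc k) t) (at t)) \<Longrightarrow> leafwise_smooth_on p n r W f \<Longrightarrow>
     leafwise_smooth_on p n r W (\<lambda>x. D k (f x))"
  unfolding leafwise_smooth_on_iff
  by (intro allI impI regular_along_compose[OF W, of D]) (use index_bound in blast)+

lemma leafwise_smooth_on_sum:
  "finite A \<Longrightarrow> (\<And>a. a \<in> A \<Longrightarrow> leafwise_smooth_on p n r W (f a)) \<Longrightarrow>
     leafwise_smooth_on p n r W (\<lambda>x. \<Sum>a\<in>A. f a x)"
  by (induction A rule: finite_induct) (auto intro: leafwise_smooth_on_const leafwise_smooth_on_add)

lemma leafwise_smooth_on_prod:
  "finite A \<Longrightarrow> (\<And>a. a \<in> A \<Longrightarrow> leafwise_smooth_on p n r W (f a)) \<Longrightarrow>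
     leafwise_smooth_on p n r W (\<lambda>x. \<Prod>a\<in>A. f a x)"
  by (induction A rule: finite_induct) (auto intro: leafwise_smooth_on_const leafwise_smooth_on_mult)

lemma leafwise_smooth_on_power:
  "leafwise_smooth_on p n r W f \<Longrightarrow> leafwise_smooth_on p n r W (\<lambda>x. f x ^ k)"
  by (induction k) (auto intro: leafwise_smooth_on_const leafwise_smooth_on_mult)

end

text \<open>The chain rule by telescoping: one coordinate is moved at a time, with the mean value
  theorem and continuity of the partial derivative in each step. The curve moves only in the first
  \<open>p\<close> coordinates near \<open>s\<close>, because \<open>G\<close> may have no
  derivatives in the transverse ones.\<close>

lemma DERIV_compose_partials:
  fixes G :: "(nat \<Rightarrow> real) \<Rightarrow> real" and \<gamma> :: "real \<Rightarrow> nat \<Rightarrow> real"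
  assumes W: "openin (Euclidean_space n) W" and "\<gamma> s \<in> W"
    and G: "\<And>i x. i < p \<Longrightarrow> x \<in> W \<Longrightarrow>
              ((\<lambda>t. G (x(i := t))) has_real_derivative partial i G x) (at (x i))"
    and cont: "\<And>i. i < p \<Longrightarrow> continuous_on W (partial i G)"
    and "p \<le> n"
    and \<gamma>: "\<And>i. i < p \<Longrightarrow> ((\<lambda>t. \<gamma> t i) has_real_derivative \<gamma>' i) (at s)"
    and const: "eventually (\<lambda>t. \<forall>i\<ge>p. \<gamma> t i = \<gamma> s i) (nhds s)"
  shows "((\<lambda>t. G (\<gamma> t)) has_real_derivative (\<Sum>i<p. partial i G (\<gamma> s) * \<gamma>' i)) (at s)"
proof -
  \<comment> \<open>Interpolates between the points \<gamma> s and \<gamma> t: the first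
    \<open>k\<close> coordinates have already been moved.\<close>
  define w where "w = (\<lambda>k t i. if i < k then \<gamma> t i else \<gamma> s i)"
  have ws: "w k s = \<gamma> s" for k
    by (auto simp: w_def)
  have s0: "\<gamma> s \<in> coord_space n"
    using openin_Euclidean_space_subset[OF W] \<open>\<gamma> s \<in> W\<close> by blast
  have \<gamma>cont: "((\<lambda>t. \<gamma> t i) \<longlongrightarrow> \<gamma> s i) (at s)" if "i < p" for i
    using DERIV_isCont[OF \<gamma>[OF that]] by (simp add: isCont_def)
  have "((\<lambda>t. G (w k t)) has_real_derivative (\<Sum>i<k. partial i G (\<gamma> s) * \<gamma>' i)) (at s)"
    if "k \<le> p" for k
    using that
  proof (induction k)
    case 0
    then show ?case by (simp add: w_def)
  next
    case (Suc k)
    then have k: "k < p" by simp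
    let ?L = "partial k G (\<gamma> s)"
    have upd: "w (Suc k) t = (w k t)(k := \<gamma> t k)" "w k t = (w k t)(k := \<gamma> s k)" for t
      by (auto simp: w_def fun_eq_iff less_Suc_eq)
    have "((\<lambda>t. G (w (Suc k) t) - G (w k t)) has_real_derivative ?L * \<gamma>' k) (at s)"
    proof -
      \<comment> \<open>Writing the increment as a product, rather than as a difference quotient in
        the coordinate, also covers those \<open>t\<close> at which the coordinate returns to its
        value at \<open>s\<close>.\<close>
      have near: "\<exists>d. eventually (\<lambda>t. G (w (Suc k) t) - G (w k t) = d t * (\<gamma> t k - \<gamma> s k)) (at s) \<and>
                 (d \<longlongrightarrow> ?L) (at s)"
      proof -
        have "\<exists>\<xi>. \<bar>\<xi> - \<gamma> s k\<bar> \<le> \<bar>\<gamma> t k - \<gamma> s k\<bar> \<and>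
            (G (w (Suc k) t) - G (w k t) = partial k G ((w k t)(k := \<xi>)) * (\<gamma> t k - \<gamma> s k))"
          if t: "\<And>\<xi>. \<bar>\<xi> - \<gamma> s k\<bar> \<le> \<bar>\<gamma> t k - \<gamma> s k\<bar> \<Longrightarrow> (w k t)(k := \<xi>) \<in> W" for t
        proof -
          let ?g = "\<lambda>\<xi>. G ((w k t)(k := \<xi>))"
          have D: "(?g has_real_derivative partial k G ((w k t)(k := \<xi>))) (at \<xi>)"
            if "\<bar>\<xi> - \<gamma> s k\<bar> \<le> \<bar>\<gamma> t k - \<gamma> s k\<bar>" for \<xi>
            using G[OF k t[OF that]] by (simp add: fun_upd_upd del: fun_upd_apply) (simp add: fun_upd_same)
          consider "\<gamma> t k = \<gamma> s k" | "\<gamma> s k < \<gamma> t k" | "\<gamma> t k < \<gamma> s k" by linarith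
          then show ?thesis
          proof cases
            case 1
            then show ?thesis using upd by (intro exI[of _ "\<gamma> s k"]) (metis abs_0 diff_self mult_zero_right order_refl)
          next
            case 2
            obtain z where "\<gamma> s k < z" "z < \<gamma> t k"
              "?g (\<gamma> t k) - ?g (\<gamma> s k) = (\<gamma> t k - \<gamma> s k) * partial k G ((w k t)(k := z))"
              using MVT2[OF 2, of ?g "\<lambda>\<xi>. partial k G ((w k t)(k := \<xi>))"] D 2 by auto
            then show ?thesis
              using upd[of t] by (intro exI[of _ z]) (auto simp: mult.commute)
          next
            case 3
            obtain z where "\<gamma> t k < z" "z < \<gamma> s k"
              "?g (\<gamma> s k) - ?g (\<gamma> t k) = (\<gamma> s k - \<gamma> t k) * partial k G ((w k t)(k := z))"
              using MVT2[OF 3, of ?g "\<lambda>\<xi>. partial k G ((w k t)(k := \<xi>))"] D 3 by auto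
            then show ?thesis
              using upd[of t] by (intro exI[of _ z]) (auto simp: algebra_simps)
          qed
        qed
        then obtain \<xi> where \<xi>: "\<And>t. (\<And>u. \<bar>u - \<gamma> s k\<bar> \<le> \<bar>\<gamma> t k - \<gamma> s k\<bar> \<Longrightarrow> (w k t)(k := u) \<in> W) \<Longrightarrow>
            \<bar>\<xi> t - \<gamma> s k\<bar> \<le> \<bar>\<gamma> t k - \<gamma> s k\<bar> \<and>
            (G (w (Suc k) t) - G (w k t) = partial k G ((w k t)(k := \<xi> t)) * (\<gamma> t k - \<gamma> s k))"
          by metis
        obtain e where e: "e > 0" "\<And>x. x \<in> coord_space n \<Longrightarrow> (\<And>j. j < n \<Longrightarrow> \<bar>x j - \<gamma> s j\<bar> < e) \<Longrightarrow> x \<in> W"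
          using Euclidean_space_box_nhd[OF W \<open>\<gamma> s \<in> W\<close>] by blast
        have close: "eventually (\<lambda>t. \<forall>i\<in>{..<p}. \<bar>\<gamma> t i - \<gamma> s i\<bar> < e) (at s)" if "e > 0" for e
          using tendstoD[OF \<gamma>cont that]
          by (intro eventually_ball_finite) (auto simp: dist_real_def)
        have wcs: "(w k t)(k := u) \<in> coord_space n" for t u
          using s0 k \<open>p \<le> n\<close> by (auto simp: w_def)
        have inW: "(w k t)(k := u) \<in> W"
          if "\<forall>i\<in>{..<p}. \<bar>\<gamma> t i - \<gamma> s i\<bar> < e" "\<bar>u - \<gamma> s k\<bar> \<le> \<bar>\<gamma> t k - \<gamma> s k\<bar>" for t u
        proof (rule e(2)[OF wcs])
          fix j assume "j < n"
          have "\<bar>u - \<gamma> s k\<bar> < e"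
            by (rule le_less_trans[OF that(2)]) (use that(1) k in simp)
          then show "\<bar>((w k t)(k := u)) j - \<gamma> s j\<bar> < e"
            using that k e(1) by (auto simp: w_def)
        qed
        have mvt: "eventually (\<lambda>t. (\<bar>\<xi> t - \<gamma> s k\<bar> \<le> \<bar>\<gamma> t k - \<gamma> s k\<bar> \<and>
            (G (w (Suc k) t) - G (w k t) = partial k G ((w k t)(k := \<xi> t)) * (\<gamma> t k - \<gamma> s k)))) (at s)"
          using close[OF e(1)] by eventually_elim (use \<xi> inW in blast)
        moreover have "((\<lambda>t. partial k G ((w k t)(k := \<xi> t))) \<longlongrightarrow> ?L) (at s)"
        proof (rule tendstoI)
          fix r :: real assume "r > 0"
          have "continuous_on W (partial k G)"
            using cont[OF k] .
          then have "openin (top_of_set W) (W \<inter> partial k G -` ball ?L r)"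
            by (rule continuous_openin_preimage_gen) auto
          then have "openin (Euclidean_space n) (W \<inter> partial k G -` ball ?L r)"
            using W unfolding Euclidean_space_eq by (rule openin_trans)
          moreover have "\<gamma> s \<in> W \<inter> partial k G -` ball ?L r"
            using \<open>\<gamma> s \<in> W\<close> \<open>r > 0\<close> by auto
          ultimately obtain e' where e': "e' > 0" "\<And>x. x \<in> coord_space n \<Longrightarrow>
              (\<And>j. j < n \<Longrightarrow> \<bar>x j - \<gamma> s j\<bar> < e') \<Longrightarrow> x \<in> W \<inter> partial k G -` ball ?L r"
            using Euclidean_space_box_nhd by blast
          show "eventually (\<lambda>t. dist (partial k G ((w k t)(k := \<xi> t))) ?L < r) (at s)"
            using close[OF e'(1)] mvt
          proof eventually_elim
            case (elim t)
            have "(w k t)(k := \<xi> t) \<in> W \<inter> partial k G -` ball ?L r"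
            proof (rule e'(2)[OF wcs])
              fix j assume "j < n"
              have "\<bar>\<xi> t - \<gamma> s k\<bar> < e'"
                by (rule le_less_trans[of _ "\<bar>\<gamma> t k - \<gamma> s k\<bar>"]) (use elim k in auto)
              then show "\<bar>((w k t)(k := \<xi> t)) j - \<gamma> s j\<bar> < e'"
                using elim k e'(1) by (auto simp: w_def)
            qed
            then show ?case
              by (auto simp: dist_commute)
          qed
        qed
        ultimately show ?thesis
          by (intro exI[of _ "\<lambda>t. partial k G ((w k t)(k := \<xi> t))"]) (auto elim: eventually_mono)
      qed
      then obtain d where d: "eventually (\<lambda>t. G (w (Suc k) t) - G (w k t) = d t * (\<gamma> t k - \<gamma> s k)) (at s)"
          "(d \<longlongrightarrow> ?L) (at s)"
        by blast
      have "((\<lambda>t. d t * ((\<gamma> t k - \<gamma> s k) / (t - s))) \<longlongrightarrow> ?L * \<gamma>' k) (at s)"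
        using \<gamma>[OF k] d(2) by (intro tendsto_mult) (auto simp: has_field_derivative_iff)
      then have "((\<lambda>t. (G (w (Suc k) t) - G (w k t)) / (t - s)) \<longlongrightarrow> ?L * \<gamma>' k) (at s)"
        by (rule Lim_transform_eventually) (use d(1) in eventually_elim, simp)
      then show ?thesis
        by (simp add: has_field_derivative_iff ws)
    qed
    from DERIV_add[OF Suc.IH this] Suc.prems show ?case
      by simp
  qed
  from this[OF order_refl]
  have "((\<lambda>t. G (w p t)) has_real_derivative (\<Sum>i<p. partial i G (\<gamma> s) * \<gamma>' i)) (at s)" .
  moreover have "eventually (\<lambda>t. w p t = \<gamma> t) (nhds s)"
    using const by eventually_elim (auto simp: w_def fun_eq_iff)
  ultimately show ?thesis
    by (subst DERIV_cong_ev[OF refl _ refl, of _ "\<lambda>t. G (w p t)"]) (auto elim: eventually_mono)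
qed

section \<open>A smooth cutoff function\<close>

text \<open>The derivatives of \<open>t \<mapsto> exp (- 1 / t)\<close>, extended by \<open>0\<close> to \<open>t \<le> 0\<close>, are
  \<open>P (1 / t) * exp (- 1 / t)\<close> with polynomials \<open>P\<close>.\<close>

fun cutoff_poly :: "nat \<Rightarrow> real poly" where
  "cutoff_poly 0 = 1"
| "cutoff_poly (Suc k) = [:0, 0, 1:] * (cutoff_poly k - pderiv (cutoff_poly k))"

definition cutoff :: "nat \<Rightarrow> real \<Rightarrow> real" where
  "cutoff k t = (if t > 0 then poly (cutoff_poly k) (1 / t) * exp (- (1 / t)) else 0)"

lemma poly_div_exp_tendsto_0: "((\<lambda>u. poly q u * exp (- u)) \<longlongrightarrow> (0 :: real)) at_top"
proof -
  have "((\<lambda>u. \<Sum>i\<le>degree q. coeff q i * (u ^ i / exp u)) \<longlongrightarrow> (\<Sum>i\<le>degree q. coeff q i * 0)) at_top"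
    by (intro tendsto_sum tendsto_mult tendsto_const tendsto_power_div_exp_0)
  then show ?thesis
    by (simp add: poly_altdef sum_divide_distrib exp_minus field_simps)
qed

text \<open>For positive t the recursion of \<open>cutoff_poly\<close> is the product rule with the
  common factor 1 / t^2 pulled out. At 0 the right difference quotient is u P(u) exp(-u) with u = 1
  / h, and the exponential beats every polynomial; from the left it vanishes identically.\<close>

lemma DERIV_cutoff: "(cutoff k has_real_derivative cutoff (Suc k) t) (at t)"
proof -
  let ?P = "cutoff_poly k"
  consider "t > 0" | "t < 0" | "t = 0" by linarith
  then show ?thesis
  proof cases
    case 1
    have "((\<lambda>t. poly ?P (1 / t) * exp (- (1 / t))) has_real_derivative
        poly (pderiv ?P) (1 / t) * (- 1 / t\<^sup>2) * exp (- (1 / t)) + poly ?P (1 / t) * (exp (- (1 / t)) * (1 / t\<^sup>2))) (at t)"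
      using 1 by (auto intro!: derivative_eq_intros DERIV_chain2[OF poly_DERIV] simp: power2_eq_square)
    also have "poly (pderiv ?P) (1 / t) * (- 1 / t\<^sup>2) * exp (- (1 / t)) +
        poly ?P (1 / t) * (exp (- (1 / t)) * (1 / t\<^sup>2)) = cutoff (Suc k) t"
      using 1 by (simp add: cutoff_def power2_eq_square field_simps)
    finally show ?thesis
    proof (subst DERIV_cong_ev[OF refl _ refl])
      show "eventually (\<lambda>t. cutoff k t = poly ?P (1 / t) * exp (- (1 / t))) (nhds t)"
        using eventually_nhds_in_open[of "{0<..}" t] 1 by (auto elim!: eventually_mono simp: cutoff_def)
    qed
  next
    case 2
    have "eventually (\<lambda>t. cutoff k t = 0) (nhds t)"
      using eventually_nhds_in_open[of "{..<0}" t] 2 by (auto elim!: eventually_mono simp: cutoff_def)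
    then show ?thesis
      using 2 by (subst DERIV_cong_ev[OF refl _ refl, of _ "\<lambda>_. 0"]) (auto simp: cutoff_def)
  next
    case 3
    have "((\<lambda>h. poly ([:0, 1:] * ?P) (1 / h) * exp (- (1 / h))) \<longlongrightarrow> 0) (at_right 0)"
      unfolding inverse_eq_divide[symmetric]
      by (rule filterlim_compose[OF poly_div_exp_tendsto_0 filterlim_inverse_at_top_right])
    moreover have "eventually (\<lambda>h. poly ([:0, 1:] * ?P) (1 / h) * exp (- (1 / h)) = cutoff k h / h) (at_right 0)"
      using eventually_at_right_less[of 0] by eventually_elim (simp add: cutoff_def)
    ultimately have "((\<lambda>h. cutoff k h / h) \<longlongrightarrow> 0) (at_right 0)"
      by (rule Lim_transform_eventually)
    moreover have "((\<lambda>h. cutoff k h / h) \<longlongrightarrow> 0) (at_left 0)"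
      by (rule Lim_transform_eventually[OF tendsto_const])
         (auto simp: eventually_at_left_field cutoff_def intro!: exI[of _ "-1"])
    ultimately have "((\<lambda>h. cutoff k h / h) \<longlongrightarrow> 0) (at 0)"
      using filterlim_split_at by blast
    then show ?thesis
      using 3 by (simp add: has_field_derivative_iff cutoff_def)
  qed
qed

lemma cutoff_0_bounds: "0 \<le> cutoff 0 t" "cutoff 0 t \<le> 1" "t > 0 \<Longrightarrow> cutoff 0 t > 0"
  by (auto simp: cutoff_def)

lemma cutoff_eq_0: "t \<le> 0 \<Longrightarrow> cutoff k t = 0"
  by (simp add: cutoff_def)

lemma continuous_on_cutoff: "continuous_on S (cutoff k)"
  using DERIV_cutoff DERIV_isCont continuous_at_imp_continuous_on by blast

section \<open>Integration over leaf coordinates\<close>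

abbreviation leaf_measure :: "nat \<Rightarrow> (nat \<Rightarrow> real) measure" where
  "leaf_measure p \<equiv> Pi\<^sub>M {..<p} (\<lambda>_. lborel)"

text \<open>Points of \<^term>\<open>leaf_measure p\<close> take the value \<^const>\<open>undefined\<close> at the indices \<open>\<ge> p\<close>.\<close>

definition proj :: "nat \<Rightarrow> (nat \<Rightarrow> real) \<Rightarrow> nat \<Rightarrow> real" where
  "proj p x = (\<lambda>i. if i < p then x i else 0)"

lemma proj_ge [simp]: "p \<le> i \<Longrightarrow> proj p x i = 0"
  by (simp add: proj_def)

lemma proj_proj [simp]: "proj p (proj p x) = proj p x"
  by (auto simp: proj_def)

lemma proj_update: "l < p \<Longrightarrow> proj p (x(l := t)) = (proj p x)(l := t)"
  by (auto simp: proj_def)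

lemma pair_point_proj [simp]: "pair_point p (proj p x) y = pair_point p x y"
  by (auto simp: pair_point_def proj_def)

lemma continuous_on_component [continuous_intros]: "continuous_on S (\<lambda>x. x (i :: 'i) :: 'b::topological_space)"
  by (rule continuous_on_product_then_coordinatewise) simp

lemma continuous_on_proj: "continuous_on S (proj p)"
proof (rule continuous_on_coordinatewise_then_product)
  show "continuous_on S (\<lambda>x. proj p x i)" for i
    by (cases "i < p") (auto simp: proj_def intro: continuous_intros)
qed

lemma measurable_proj: "proj p \<in> borel_measurable (leaf_measure p)"
proof (rule measurable_coordinatewise_then_product)
  show "(\<lambda>x. proj p x i) \<in> borel_measurable (leaf_measure p)" for i
  proof (cases "i < p")
    case True
    then have "(\<lambda>x. x i) \<in> measurable (leaf_measure p) lborel"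
      by (intro measurable_component_singleton) auto
    then show ?thesis
      using True by (simp add: proj_def)
  qed (simp add: proj_def)
qed

lemma compact_coordinates_bounded:
  assumes "compact (D :: (nat \<Rightarrow> real) set)"
  obtains R where "R > 0" "\<And>x j. x \<in> D \<Longrightarrow> j < p \<Longrightarrow> \<bar>x j\<bar> < R"
proof -
  have "\<exists>R. \<forall>x\<in>D. \<bar>x j\<bar> \<le> R" for j
  proof -
    have "bounded ((\<lambda>x. x j) ` D)"
      by (intro compact_imp_bounded compact_continuous_image assms continuous_intros)
    then show ?thesis
      by (auto simp: bounded_iff)
  qed
  then obtain R where R: "\<And>j x. x \<in> D \<Longrightarrow> \<bar>x j\<bar> \<le> R j"
    by metis
  show thesis
  \<comment> \<open>The sum dominates each single bound; the summand 1 makes the inequality strict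
    and the radius positive even for \<open>p = 0\<close>.\<close>
  proof (rule that[of "(\<Sum>j<p. \<bar>R j\<bar>) + 1"])
    show "(\<Sum>j<p. \<bar>R j\<bar>) + 1 > 0"
      by (simp add: add_nonneg_pos sum_nonneg)
    fix x j assume "x \<in> D" "j < p"
    then have "\<bar>x j\<bar> \<le> \<bar>R j\<bar>"
      using R by (meson abs_ge_self order_trans)
    also have "\<dots> \<le> (\<Sum>j<p. \<bar>R j\<bar>)"
      using \<open>j < p\<close> by (intro member_le_sum) auto
    finally show "\<bar>x j\<bar> < (\<Sum>j<p. \<bar>R j\<bar>) + 1"
      by simp
  qed
qed

lemma leaf_box:
  assumes "(0::real) \<le> R"
  shows "Pi\<^sub>E {..<p} (\<lambda>_. {-R..R}) \<in> sets (leaf_measure p)"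
    and "emeasure (leaf_measure p) (Pi\<^sub>E {..<p} (\<lambda>_. {-R..R})) = ennreal ((2 * R) ^ p)"
proof -
  interpret product_sigma_finite "\<lambda>_::nat. lborel :: real measure"
    by standard
  show "Pi\<^sub>E {..<p} (\<lambda>_. {-R..R}) \<in> sets (leaf_measure p)"
    by (intro sets_PiM_I_finite) auto
  have "emeasure (leaf_measure p) (Pi\<^sub>E {..<p} (\<lambda>_. {-R..R})) = (\<Prod>i<p. ennreal (2 * R))"
    using assms by (subst emeasure_PiM) auto
  also have "\<dots> = ennreal ((2 * R) ^ p)"
    using assms by (subst prod_ennreal) auto
  finally show "emeasure (leaf_measure p) (Pi\<^sub>E {..<p} (\<lambda>_. {-R..R})) = ennreal ((2 * R) ^ p)" .
qed

text \<open>The function is bounded and, read through \<open>proj p\<close>, vanishes off a box of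
  finite measure.\<close>

lemma integrable_compact_support:
  fixes f :: "(nat \<Rightarrow> real) \<Rightarrow> real"
  assumes f: "continuous_on (coord_space p) f"
    and D: "compact D" "D \<subseteq> coord_space p" "\<And>x. x \<in> coord_space p - D \<Longrightarrow> f x = 0"
  shows "integrable (leaf_measure p) (\<lambda>x. f (proj p x))"
proof -
  obtain R where R: "R > 0" "\<And>x j. x \<in> D \<Longrightarrow> j < p \<Longrightarrow> \<bar>x j\<bar> < R"
    using compact_coordinates_bounded[OF D(1)] by metis
  have "bounded (f ` D)"
    by (intro compact_imp_bounded compact_continuous_image D continuous_on_subset[OF f])
  then obtain B where B: "\<And>x. x \<in> D \<Longrightarrow> \<bar>f x\<bar> \<le> B"
    by (auto simp: bounded_iff)
  have "continuous_on UNIV (\<lambda>x. f (proj p x))"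
    by (intro continuous_on_compose2[OF f continuous_on_proj]) (auto simp: proj_def)
  then have "(\<lambda>x. f (proj p x)) \<in> borel_measurable borel"
    by (rule borel_measurable_continuous_onI)
  from measurable_compose[OF measurable_proj[of p] this]
  have meas: "(\<lambda>x. f (proj p x)) \<in> borel_measurable (leaf_measure p)"
    by simp
  show ?thesis
  proof (rule integrableI_bounded_set[OF _ meas])
    show "Pi\<^sub>E {..<p} (\<lambda>_. {-R..R}) \<in> sets (leaf_measure p)"
      using R(1) by (intro leaf_box) auto
    show "emeasure (leaf_measure p) (Pi\<^sub>E {..<p} (\<lambda>_. {-R..R})) < \<infinity>"
      using R(1) by (subst leaf_box) auto
    have "f (proj p x) = 0" if x: "x \<in> space (leaf_measure p)" "x \<notin> Pi\<^sub>E {..<p} (\<lambda>_. {-R..R})" for x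
    proof -
      obtain j where "j < p" "x j \<notin> {-R..R}"
        using x by (auto simp: space_PiM PiE_iff)
      then have "proj p x \<notin> D"
        using R(2)[of "proj p x" j] by (auto simp: proj_def)
      then show ?thesis
        using D(3) by (simp add: proj_def)
    qed
    then show "AE x in leaf_measure p. x \<notin> Pi\<^sub>E {..<p} (\<lambda>_. {-R..R}) \<longrightarrow> f (proj p x) = 0"
      by (intro AE_I2) blast
    have "norm (f (proj p x)) \<le> max B 0" for x
      using B[of "proj p x"] D(3)[of "proj p x"] by (cases "proj p x \<in> D") auto
    then show "AE x in leaf_measure p. x \<in> Pi\<^sub>E {..<p} (\<lambda>_. {-R..R}) \<longrightarrow> norm (f (proj p x)) \<le> max B 0"
      by simp
  qed
qed

text \<open>By Fubini the coordinate \<open>l\<close> may be integrated first, and the fundamental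
  theorem of calculus turns this inner integral into two values of \<open>g\<close> outside the
  support.\<close>

lemma integral_partial_eq_0:
  fixes g g' :: "(nat \<Rightarrow> real) \<Rightarrow> real"
  assumes "l < p" and g': "continuous_on (coord_space p) g'"
    and D: "compact D" "D \<subseteq> coord_space p"
    and zero: "\<And>x. x \<in> coord_space p - D \<Longrightarrow> g x = 0" "\<And>x. x \<in> coord_space p - D \<Longrightarrow> g' x = 0"
    and deriv: "\<And>x. x \<in> coord_space p \<Longrightarrow> ((\<lambda>t. g (x(l := t))) has_real_derivative g' x) (at (x l))"
  shows "(\<integral>x. g' (proj p x) \<partial>(leaf_measure p)) = 0"
proof -
  interpret product_sigma_finite "\<lambda>_::nat. lborel :: real measure"
    by standard
  let ?I = "{..<p} - {l}"
  have I: "{..<p} = insert l ?I"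
    using \<open>l < p\<close> by auto
  obtain R where R: "R > 0" "\<And>x j. x \<in> D \<Longrightarrow> j < p \<Longrightarrow> \<bar>x j\<bar> < R"
    using compact_coordinates_bounded[OF D(1)] by metis
  have int: "integrable (leaf_measure p) (\<lambda>x. g' (proj p x))"
    by (rule integrable_compact_support[OF g' D zero(2)])
  have inner: "(\<integral>t. g' (proj p (x(l := t))) \<partial>lborel) = 0" for x
  proof -
    let ?z = "proj p x"
    have cs: "?z(l := t) \<in> coord_space p" for t
      using \<open>l < p\<close> by (simp add: proj_def)
    \<comment> \<open>\<open>R\<close> bounds the coordinates of \<open>D\<close> strictly, so the
      end points R and -R already lie outside \<open>D\<close>.\<close>
    have out: "?z(l := t) \<notin> D" if "R \<le> \<bar>t\<bar>" for t
      using R(2)[OF _ \<open>l < p\<close>, of "?z(l := t)"] that by auto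
    have g0: "g (?z(l := t)) = 0" "g' (?z(l := t)) = 0" if "R \<le> \<bar>t\<bar>" for t
      using zero out[OF that] cs by blast+
    have "(\<integral>t. g' (proj p (x(l := t))) \<partial>lborel) = (\<integral>t. g' (?z(l := t)) * indicator {-R..R} t \<partial>lborel)"
    proof (intro Bochner_Integration.integral_cong refl)
      fix t
      show "g' (proj p (x(l := t))) = g' (?z(l := t)) * indicator {-R..R} t"
        using g0(2)[of t] \<open>l < p\<close> by (cases "\<bar>t\<bar> \<le> R") (auto simp: proj_update indicator_def)
    qed
    also have "\<dots> = g (?z(l := R)) - g (?z(l := - R))"
    proof (rule integral_FTC_Icc_real)
      show "- R \<le> R" using R(1) by simp
      show "((\<lambda>t. g (?z(l := t))) has_real_derivative g' (?z(l := t))) (at t)" for t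
        using deriv[OF cs, of t] by (simp add: fun_upd_upd del: fun_upd_apply) (simp add: fun_upd_same)
      have "continuous_on UNIV (\<lambda>t. g' (?z(l := t)))"
        by (rule continuous_on_compose2[OF g' continuous_on_update]) (use cs in auto)
      then show "isCont (\<lambda>t. g' (?z(l := t))) t" for t
        by (simp add: continuous_on_eq_continuous_at)
    qed
    also have "\<dots> = 0"
      using g0(1)[of R] g0(1)[of "- R"] R(1) by simp
    finally show ?thesis .
  qed
  have "(\<integral>x. g' (proj p x) \<partial>(leaf_measure p)) =
        (\<integral>x. (\<integral>t. g' (proj p (x(l := t))) \<partial>lborel) \<partial>(Pi\<^sub>M ?I (\<lambda>_. lborel)))"
    using product_integral_insert[of ?I l "\<lambda>x. g' (proj p x)"] int I by simp
  also have "\<dots> = 0"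
    by (simp add: inner)
  finally show ?thesis .
qed

section \<open>A cutoff function around a compact set\<close>

text \<open>The square makes the positive part continuously differentiable across 0, which is all
  the smoothness that a single integration by parts asks of \<psi>.\<close>

lemma DERIV_max_0_squared: "((\<lambda>t. (max 0 t)\<^sup>2) has_real_derivative 2 * max 0 t) (at (t :: real))"
proof -
  consider "t > 0" | "t < 0" | "t = 0" by linarith
  then show ?thesis
  proof cases
    case 1
    have "((\<lambda>t. t\<^sup>2) has_real_derivative 2 * t) (at t)"
      by (auto intro!: derivative_eq_intros)
    moreover have "eventually (\<lambda>t. (max 0 t)\<^sup>2 = t\<^sup>2) (nhds t)"
      using eventually_nhds_in_open[of "{0<..}" t] 1 by (auto elim!: eventually_mono)
    ultimately show ?thesis
      using 1 by (subst DERIV_cong_ev[OF refl _ refl, of _ "\<lambda>t. t\<^sup>2"]) auto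
  next
    case 2
    have "eventually (\<lambda>t. (max 0 t)\<^sup>2 = 0) (nhds t)"
      using eventually_nhds_in_open[of "{..<0}" t] 2 by (auto elim!: eventually_mono)
    then show ?thesis
      using 2 by (subst DERIV_cong_ev[OF refl _ refl, of _ "\<lambda>_. 0"]) auto
  next
    case 3
    have "((\<lambda>h::real. (max 0 h)\<^sup>2 / h) \<longlongrightarrow> 0) (at 0)"
    proof (rule Lim_null_comparison[of _ "\<lambda>h. \<bar>h\<bar>"])
      have "norm ((max 0 h)\<^sup>2 / h) \<le> \<bar>h\<bar>" for h :: real
        by (cases "h \<le> 0") (auto simp: power2_eq_square)
      then show "eventually (\<lambda>h::real. norm ((max 0 h)\<^sup>2 / h) \<le> \<bar>h\<bar>) (at 0)"
        by simp
      show "((\<lambda>h::real. \<bar>h\<bar>) \<longlongrightarrow> 0) (at 0)"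
        using tendsto_rabs_zero[OF tendsto_ident_at] by simp
    qed
    then show ?thesis
      using 3 by (simp add: has_field_derivative_iff)
  qed
qed

text \<open>Finitely many balls contained in \<open>S\<close> cover \<open>K\<close>; the sum
  \<beta> of a bump on each of them is bounded below on \<open>K\<close> by compactness, and \<psi>
  is obtained by flattening \<beta> to 1 above half of that bound. All these functions involve only
  the coordinates below \<open>p\<close>, hence make sense on the whole function space.\<close>

lemma cutoff_function_exists:
  assumes O: "openin (Euclidean_space p) S" "S \<subseteq> U" "compact U"
    and K: "compact K" "K \<subseteq> S" "K \<noteq> {}"
  obtains \<psi> :: "(nat \<Rightarrow> real) \<Rightarrow> real" and d\<psi> :: "nat \<Rightarrow> (nat \<Rightarrow> real) \<Rightarrow> real" and D C
  where "compact D" "D \<subseteq> S" "\<And>x. x \<in> coord_space p - D \<Longrightarrow> \<psi> x = 0"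
    "compact C" "C \<subseteq> D" "C \<inter> K = {}" "\<And>x l. x \<in> coord_space p - C \<Longrightarrow> d\<psi> l x = 0"
    "continuous_on UNIV \<psi>" "\<And>l. continuous_on UNIV (d\<psi> l)"
    "\<And>x l. l < p \<Longrightarrow> ((\<lambda>t. \<psi> (x(l := t))) has_real_derivative d\<psi> l x) (at (x l))"
    "\<And>x. 0 \<le> \<psi> x" "\<And>x. \<psi> x \<le> 1" "\<And>x. x \<in> K \<Longrightarrow> \<psi> x = 1"
proof -
  define d where "d = (\<lambda>a x :: nat \<Rightarrow> real. \<Sum>j<p. (x j - a j)\<^sup>2)"
  have dcont: "continuous_on T (d a)" for a T
    unfolding d_def by (intro continuous_intros)
  have "\<exists>r>0. \<forall>x. x \<in> coord_space p \<and> d a x \<le> r \<longrightarrow> x \<in> S" if "a \<in> K" for a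
  proof -
    obtain e where e: "e > 0" "\<And>x. x \<in> coord_space p \<Longrightarrow> (\<And>j. j < p \<Longrightarrow> \<bar>x j - a j\<bar> < e) \<Longrightarrow> x \<in> S"
      using Euclidean_space_box_nhd[OF O(1), of a] \<open>a \<in> K\<close> K(2) by blast
    \<comment> \<open>Radii are squared, since \<open>d a\<close> is the squared distance; halving
      \<open>e\<close> makes even the closed ball fit into the open box.\<close>
    have "x \<in> S" if x: "x \<in> coord_space p" "d a x \<le> (e / 2)\<^sup>2" for x
    proof (rule e(2)[OF x(1)])
      fix j assume "j < p"
      then have "(x j - a j)\<^sup>2 \<le> d a x"
        unfolding d_def by (intro member_le_sum) auto
      with x(2) have "(x j - a j)\<^sup>2 \<le> (e / 2)\<^sup>2"
        by linarith
      then have "\<bar>x j - a j\<bar> \<le> e / 2"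
        using e(1) by (simp add: abs_le_square_iff[symmetric])
      then show "\<bar>x j - a j\<bar> < e"
        using e(1) by linarith
    qed
    then show ?thesis
      using e(1) by (intro exI[of _ "(e / 2)\<^sup>2"]) auto
  qed
  then have "\<forall>a\<in>K. \<exists>r. r > 0 \<and> (\<forall>x. x \<in> coord_space p \<and> d a x \<le> r \<longrightarrow> x \<in> S)"
    by blast
  from bchoice[OF this] obtain r where
    "\<forall>a\<in>K. r a > 0 \<and> (\<forall>x. x \<in> coord_space p \<and> d a x \<le> r a \<longrightarrow> x \<in> S)"
    by blast
  then have r: "\<And>a. a \<in> K \<Longrightarrow> r a > 0"
      "\<And>a x. a \<in> K \<Longrightarrow> x \<in> coord_space p \<Longrightarrow> d a x \<le> r a \<Longrightarrow> x \<in> S"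
    by blast+
  have "open {x. d a x < r a}" for a
    by (intro open_Collect_less dcont continuous_intros)
  moreover have "K \<subseteq> (\<Union>a\<in>K. {x. d a x < r a})"
    using r(1) by (force simp: d_def)
  ultimately obtain A where A: "A \<subseteq> K" "finite A" "K \<subseteq> (\<Union>a\<in>A. {x. d a x < r a})"
    by (rule compactE_image[OF K(1)])
  define D where "D = coord_space p \<inter> (\<Union>a\<in>A. {x. d a x \<le> r a})"
  define \<beta> where "\<beta> = (\<lambda>x. \<Sum>a\<in>A. (max 0 (r a - d a x))\<^sup>2)"
  define d\<beta> where "d\<beta> = (\<lambda>l x. \<Sum>a\<in>A. 2 * max 0 (r a - d a x) * - (2 * (x l - a l)))"
  have \<beta>cont: "continuous_on T \<beta>" for T
    unfolding \<beta>_def by (intro continuous_intros dcont)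
  have \<beta>0: "0 \<le> \<beta> x" for x
    unfolding \<beta>_def by (intro sum_nonneg) auto
  have \<beta>pos: "0 < \<beta> x" if "x \<in> K" for x
  proof -
    obtain a where "a \<in> A" "d a x < r a"
      using A(3) \<open>x \<in> K\<close> by auto
    then show ?thesis
      unfolding \<beta>_def using A(2) by (intro sum_pos2[of _ a]) auto
  qed
  obtain z where z: "z \<in> K" "\<And>x. x \<in> K \<Longrightarrow> \<beta> z \<le> \<beta> x"
    using continuous_attains_inf[OF K(1,3) \<beta>cont] by blast
  define \<epsilon> where "\<epsilon> = \<beta> z"
  have \<epsilon>: "\<epsilon> > 0" "\<And>x. x \<in> K \<Longrightarrow> \<epsilon> \<le> \<beta> x"
    using z \<beta>pos by (auto simp: \<epsilon>_def)
  \<comment> \<open>This is 0 where \<beta> = 0 and 1 where \<beta> >= \<epsilon> / 2. The factor 2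
    leaves a margin: \<psi> is constant on a neighbourhood of \<open>K\<close>, where \<beta> >=
    \<epsilon>, and not merely on \<open>K\<close>.\<close>
  define \<psi> where "\<psi> = (\<lambda>x. 1 - (max 0 (1 - 2 / \<epsilon> * \<beta> x))\<^sup>2)"
  define d\<psi> where "d\<psi> = (\<lambda>l x. - (2 * max 0 (1 - 2 / \<epsilon> * \<beta> x) * (- (2 / \<epsilon> * d\<beta> l x))))"
  \<comment> \<open>The derivatives of \<psi> vanish where \<beta> > \<epsilon> / 2 and off
    \<open>D\<close>, so they live on this compact set, which misses \<open>K\<close> by the
    margin.\<close>
  define C where "C = D \<inter> {x. \<beta> x \<le> \<epsilon> / 2}"
  have outD: "\<beta> x = 0" "d\<beta> l x = 0" if "x \<in> coord_space p - D" for x l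
    using that by (auto simp: \<beta>_def d\<beta>_def D_def intro!: sum.neutral)
  have Ddef: "D = (\<Inter>i\<in>{p..}. {x. x i = 0}) \<inter> (\<Union>a\<in>A. {x. d a x \<le> r a})"
    by (auto simp: D_def)
  have "closed D"
    unfolding Ddef
    by (intro closed_Int closed_INT closed_UN ballI closed_Collect_le closed_Collect_eq A dcont continuous_intros)
  moreover have "D \<subseteq> S"
    using r(2) A(1) by (auto simp: D_def)
  ultimately have D: "compact D" "D \<subseteq> S"
    using O by (metis compact_Int_closed inf.absorb_iff2 order_trans)+
  show thesis
  proof (rule that[of D \<psi> C d\<psi>])
    show "compact D" "D \<subseteq> S" "C \<subseteq> D"
      using D by (auto simp: C_def)
    show "compact C"
      unfolding C_def by (intro compact_Int_closed D closed_Collect_le \<beta>cont continuous_intros)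
    show "C \<inter> K = {}"
      using \<epsilon> by (force simp: C_def)
    show "\<psi> x = 0" if "x \<in> coord_space p - D" for x
      using outD[OF that] by (simp add: \<psi>_def)
    show "d\<psi> l x = 0" if "x \<in> coord_space p - C" for x l
    proof (cases "x \<in> D")
      case True
      then have "1 - 2 / \<epsilon> * \<beta> x < 0"
        using that \<epsilon>(1) by (auto simp: C_def field_simps)
      then show ?thesis
        by (simp add: d\<psi>_def)
    next
      case False
      then show ?thesis
        using outD(2)[of x] that by (simp add: d\<psi>_def)
    qed
    show "continuous_on UNIV \<psi>"
      unfolding \<psi>_def by (intro continuous_intros \<beta>cont)
    show "continuous_on UNIV (d\<psi> l)" for l
      unfolding d\<psi>_def d\<beta>_def by (intro continuous_intros \<beta>cont dcont)
    show "0 \<le> \<psi> x" "\<psi> x \<le> 1" for x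
    proof -
      have "max 0 (1 - 2 / \<epsilon> * \<beta> x) \<le> 1"
        using \<epsilon>(1) \<beta>0[of x] by simp
      then show "0 \<le> \<psi> x" "\<psi> x \<le> 1"
        by (auto simp: \<psi>_def power_le_one)
    qed
    show "\<psi> x = 1" if "x \<in> K" for x
    proof -
      have "1 - 2 / \<epsilon> * \<beta> x \<le> 0"
        using \<epsilon>(1) \<epsilon>(2)[OF that] by (simp add: field_simps)
      then show ?thesis
        by (simp add: \<psi>_def)
    qed
    fix x l assume "l < p"
    have dd: "((\<lambda>t. d a (x(l := t))) has_real_derivative 2 * (x l - a l)) (at (x l))" for a
    proof -
      have "d a (x(l := t)) = (\<Sum>j\<in>{..<p} - {l}. (x j - a j)\<^sup>2) + (t - a l)\<^sup>2" for t
        using \<open>l < p\<close> unfolding d_def by (subst sum.remove[of _ l]) auto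
      then show ?thesis
        by (auto intro!: derivative_eq_intros)
    qed
    have d\<beta>: "((\<lambda>t. \<beta> (x(l := t))) has_real_derivative d\<beta> l x) (at (x l))"
      unfolding \<beta>_def d\<beta>_def
    proof (rule DERIV_sum)
      fix a
      have "((\<lambda>t. r a - d a (x(l := t))) has_real_derivative - (2 * (x l - a l))) (at (x l))"
        using DERIV_diff[OF DERIV_const dd] by simp
      from DERIV_chain2[OF DERIV_max_0_squared this]
      show "((\<lambda>t. (max 0 (r a - d a (x(l := t))))\<^sup>2) has_real_derivative
          2 * max 0 (r a - d a x) * - (2 * (x l - a l))) (at (x l))"
        by simp
    qed
    have "((\<lambda>t. 1 - 2 / \<epsilon> * \<beta> (x(l := t))) has_real_derivative - (2 / \<epsilon> * d\<beta> l x)) (at (x l))"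
      using DERIV_diff[OF DERIV_const[of 1] DERIV_cmult[OF d\<beta>, of "2 / \<epsilon>"]] by simp
    from DERIV_diff[OF DERIV_const DERIV_chain2[OF DERIV_max_0_squared this]]
    show "((\<lambda>t. \<psi> (x(l := t))) has_real_derivative d\<psi> l x) (at (x l))"
      unfolding \<psi>_def d\<psi>_def by simp
  qed
qed

section \<open>Pairing leafwise forms with a cutoff function\<close>

lemma pair_point_update: "l < p \<Longrightarrow> pair_point p (x(l := t)) y = (pair_point p x y)(l := t)"
  by (auto simp: pair_point_def)

lemma pair_point_nth: "l < p \<Longrightarrow> pair_point p x y l = x l"
  by (simp add: pair_point_def)

lemma continuous_on_pair_point:
  assumes "continuous_on S f" "continuous_on S g"
  shows "continuous_on S (\<lambda>z. pair_point p (f z) (g z))"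
proof (rule continuous_on_coordinatewise_then_product)
  fix i
  show "continuous_on S (\<lambda>z. pair_point p (f z) (g z) i)"
    by (cases "i < p")
       (auto simp: pair_point_def intro: continuous_on_product_then_coordinatewise assms)
qed

lemma compact_range_with_limit:
  fixes y :: "nat \<Rightarrow> 'a::topological_space"
  assumes "y \<longlonglongrightarrow> l"
  shows "compact (insert l (range y))"
  using compactin_sequence_with_limit[of euclidean y l "range y"] assms by simp

text \<open>Integration by parts replaces the derivative of \<open>f\<close> by a derivative of
  \<psi>, which is supported in \<open>C\<close>. There \<open>f\<close> is needed only on the
  compact product of \<open>C\<close> with the sequence and its limit, which lies in
  \<open>W\<close>. Over \<open>D\<close> no such bound is available, since the limit slice may
  leave \<open>W\<close>.\<close>

lemma leafwise_derivative_pairing_bounded: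
  fixes \<psi> :: "(nat \<Rightarrow> real) \<Rightarrow> real" and d\<psi> :: "nat \<Rightarrow> (nat \<Rightarrow> real) \<Rightarrow> real"
  assumes S: "openin (Euclidean_space p) S"
    and D: "compact D" "D \<subseteq> S" "\<And>x. x \<in> coord_space p - D \<Longrightarrow> \<psi> x = 0"
    and C: "compact C" "C \<subseteq> D" "\<And>x l. x \<in> coord_space p - C \<Longrightarrow> d\<psi> l x = 0"
    and \<psi>: "continuous_on UNIV \<psi>" and d\<psi>: "\<And>l. continuous_on UNIV (d\<psi> l)"
    and deriv: "\<And>x l. l < p \<Longrightarrow> ((\<lambda>t. \<psi> (x(l := t))) has_real_derivative d\<psi> l x) (at (x l))"
    and y: "y \<longlonglongrightarrow> (\<lambda>_. 0)"
    and slices: "\<And>x k. x \<in> S \<Longrightarrow> pair_point p x (y k) \<in> W" "\<And>x. x \<in> C \<Longrightarrow> pair_point p x (\<lambda>_. 0) \<in> W"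
    and f: "leafwise_smooth_on p n r W f" and "l < p"
  obtains B where "\<And>k. integrable (leaf_measure p) (\<lambda>x. \<psi> (proj p x) * partial l f (pair_point p x (y k)))"
    "\<And>k. \<bar>\<integral>x. \<psi> (proj p x) * partial l f (pair_point p x (y k)) \<partial>(leaf_measure p)\<bar> \<le> B"
proof -
  note Scs = openin_Euclidean_space_subset[OF S]
  let ?Y = "insert (\<lambda>_. 0) (range y)"
  have "compact ((\<lambda>z. pair_point p (fst z) (snd z)) ` (C \<times> ?Y))"
    by (intro compact_continuous_image compact_Times C compact_range_with_limit y
          continuous_on_pair_point continuous_on_fst continuous_on_snd continuous_on_id)
  moreover have "(\<lambda>z. pair_point p (fst z) (snd z)) ` (C \<times> ?Y) \<subseteq> W"
    using slices C(2) D(2) by fastforce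
  ultimately have "compact (f ` (\<lambda>z. pair_point p (fst z) (snd z)) ` (C \<times> ?Y))"
    using leafwise_smooth_on_continuous[OF f] by (meson compact_continuous_image continuous_on_subset)
  then have "bounded (f ` (\<lambda>z. pair_point p (fst z) (snd z)) ` (C \<times> ?Y))"
    by (rule compact_imp_bounded)
  then obtain b where b: "\<And>x k. x \<in> C \<Longrightarrow> \<bar>f (pair_point p x (y k))\<bar> \<le> b"
    by (fastforce simp: bounded_iff)
  have Dcs: "D \<subseteq> coord_space p" and "closed D"
    using D Scs compact_imp_closed by blast+
  have openD: "openin (Euclidean_space p) (coord_space p - D)"
    unfolding Euclidean_space_eq Diff_eq using \<open>closed D\<close> by (intro openin_open_Int) auto
  have d\<psi>D: "d\<psi> l x = 0" if "x \<in> coord_space p - D" for x l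
    using C that by blast
  \<comment> \<open>The factor \<open>v\<close> is continuous only on \<open>S\<close>; as
    \<open>u\<close> vanishes off \<open>D\<close>, the product is continuous on each of the two
    open sets \<open>S\<close> and the complement of \<open>D\<close>, which together cover the
    space.\<close>
  have extend: "continuous_on (coord_space p) (\<lambda>x. u x * v x)"
    if "continuous_on UNIV u" "\<And>x. x \<in> coord_space p - D \<Longrightarrow> u x = 0" "continuous_on S v"
    for u v :: "(nat \<Rightarrow> real) \<Rightarrow> real"
  proof (rule continuous_on_openin_local[OF order_refl])
    fix x assume x: "x \<in> coord_space p"
    show "\<exists>W'. openin (top_of_set (coord_space p)) W' \<and> x \<in> W' \<and> continuous_on W' (\<lambda>x. u x * v x)"
    proof (cases "x \<in> D")
      case True
      then show ?thesis
        using S D(2) that(1,3) unfolding Euclidean_space_eq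
        by (intro exI[of _ S]) (auto intro!: continuous_intros intro: continuous_on_subset)
    next
      case False
      have "continuous_on (coord_space p - D) (\<lambda>x. u x * v x)"
        by (subst continuous_on_cong[OF refl, of _ _ "\<lambda>_. 0"]) (auto simp: that(2))
      then show ?thesis
        using openD x False unfolding Euclidean_space_eq by blast
    qed
  qed
  define A where "A = (\<integral>x. \<bar>d\<psi> l (proj p x)\<bar> \<partial>(leaf_measure p))"
  show thesis
  proof (rule that[of "A * b"])
    fix k
    let ?P = "\<lambda>x. pair_point p x (y k)"
    have slice: "continuous_on S (\<lambda>x. h (?P x))" if "continuous_on W h" for h :: "_ \<Rightarrow> real"
      by (rule continuous_on_compose2[OF that continuous_on_pair_point])
         (use slices(1) in \<open>auto intro: continuous_intros\<close>)
    have fcont: "continuous_on S (\<lambda>x. f (?P x))" "continuous_on S (\<lambda>x. partial l f (?P x))"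
      using f leafwise_smooth_on_partial[OF f \<open>l < p\<close>]
      by (auto intro!: slice intro: leafwise_smooth_on_continuous)
    let ?g = "\<lambda>x. \<psi> x * f (?P x)"
    let ?u = "\<lambda>x. d\<psi> l x * f (?P x)" and ?v = "\<lambda>x. \<psi> x * partial l f (?P x)"
    have uc: "continuous_on (coord_space p) ?u" and vc: "continuous_on (coord_space p) ?v"
      using extend \<psi> d\<psi> D(3) d\<psi>D fcont by blast+
    have u0: "?u x = 0" and v0: "?v x = 0" if "x \<in> coord_space p - D" for x
      using D(3)[OF that] d\<psi>D[OF that] by auto
    have "((\<lambda>t. ?g (x(l := t))) has_real_derivative ?u x + ?v x) (at (x l))" if x: "x \<in> coord_space p" for x
    proof (cases "x \<in> D")
      case True
      have "((\<lambda>t. f ((?P x)(l := t))) has_real_derivative partial l f (?P x)) (at ((?P x) l))"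
        using leafwise_smooth_on_DERIV[OF f \<open>l < p\<close>] slices(1) True D(2) by blast
      then have "((\<lambda>t. f (?P (x(l := t)))) has_real_derivative partial l f (?P x)) (at (x l))"
        using \<open>l < p\<close> by (simp add: pair_point_update pair_point_nth)
      from DERIV_mult[OF deriv[OF \<open>l < p\<close>, of x] this] show ?thesis
        by (simp add: algebra_simps del: fun_upd_apply)
    next
      case False
      \<comment> \<open>Off \<open>D\<close> the product vanishes on a whole interval of the
        coordinate line, so no differentiability of \<open>f\<close> is required there.\<close>
      have "eventually (\<lambda>t. x(l := t) \<in> coord_space p - D) (nhds (x l))"
        using openD \<open>l < p\<close> by (rule eventually_update_in) (use x False in auto)
      then have "eventually (\<lambda>t. ?g (x(l := t)) = 0) (nhds (x l))"
        by eventually_elim (use D(3) in simp)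
      then show ?thesis
        using u0[of x] v0[of x] x False by (subst DERIV_cong_ev[OF refl _ refl, of _ "\<lambda>_. 0"]) auto
    qed
    then have sum0: "(\<integral>x. ?u (proj p x) + ?v (proj p x) \<partial>(leaf_measure p)) = 0"
      using uc vc D(3) u0 v0
      by (intro integral_partial_eq_0[OF \<open>l < p\<close> _ D(1) Dcs, of "\<lambda>x. ?u x + ?v x" ?g])
         (auto intro: continuous_intros)
    have iu: "integrable (leaf_measure p) (\<lambda>x. ?u (proj p x))"
      and iv: "integrable (leaf_measure p) (\<lambda>x. ?v (proj p x))"
      using u0 v0 by (intro integrable_compact_support[OF _ D(1) Dcs] uc vc; blast)+
    show "integrable (leaf_measure p) (\<lambda>x. \<psi> (proj p x) * partial l f (?P x))"
      using iv by simp
    have "(\<integral>x. ?v (proj p x) \<partial>(leaf_measure p)) = - (\<integral>x. ?u (proj p x) \<partial>(leaf_measure p))"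
      using sum0 Bochner_Integration.integral_add[OF iu iv] by linarith
    then have "\<bar>\<integral>x. ?v (proj p x) \<partial>(leaf_measure p)\<bar> = \<bar>\<integral>x. ?u (proj p x) \<partial>(leaf_measure p)\<bar>"
      by simp
    also have "\<dots> \<le> (\<integral>x. \<bar>?u (proj p x)\<bar> \<partial>(leaf_measure p))"
      by (rule integral_abs_bound)
    also have "\<dots> \<le> (\<integral>x. \<bar>d\<psi> l (proj p x)\<bar> * b \<partial>(leaf_measure p))"
    proof (rule integral_mono)
      show "integrable (leaf_measure p) (\<lambda>x. \<bar>?u (proj p x)\<bar>)"
        using iu by (rule integrable_abs)
      have "integrable (leaf_measure p) (\<lambda>x. d\<psi> l (proj p x))"
        by (rule integrable_compact_support[OF continuous_on_subset[OF d\<psi>] D(1) Dcs]) (use d\<psi>D in auto)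
      then show "integrable (leaf_measure p) (\<lambda>x. \<bar>d\<psi> l (proj p x)\<bar> * b)"
        by (intro integrable_mult_left integrable_abs)
      fix x
      show "\<bar>?u (proj p x)\<bar> \<le> \<bar>d\<psi> l (proj p x)\<bar> * b"
        using b[of "proj p x" k] C(3)[of "proj p x" l]
        by (cases "proj p x \<in> C") (auto simp: abs_mult mult_left_mono proj_def)
    qed
    also have "\<dots> = A * b"
      by (simp add: A_def)
    finally show "\<bar>\<integral>x. \<psi> (proj p x) * partial l f (pair_point p x (y k)) \<partial>(leaf_measure p)\<bar> \<le> A * b"
      by simp
  qed
qed

section \<open>Unboundedness of the pairing\<close>

text \<open>If some coefficient were nonzero, the highest occurring order \<open>d\<close> would
  determine the sign near q = 0, the region away from the pole would contribute a bounded amount,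
  and a small box around 0 would contribute at least a constant times s_k^(p - d), where d >
  p.\<close>

lemma pole_pairing_unbounded:
  fixes \<psi> :: "(nat \<Rightarrow> real) \<Rightarrow> real" and a :: "nat \<Rightarrow> real" and s :: "nat \<Rightarrow> real"
  assumes D: "compact D" "D \<subseteq> coord_space p" "\<And>x. x \<in> coord_space p - D \<Longrightarrow> \<psi> x = 0"
    and \<psi>: "continuous_on UNIV \<psi>" "\<And>x. 0 \<le> \<psi> x" "\<And>x. \<psi> x \<le> 1"
    and e: "e > 0" "\<And>x. x \<in> coord_space p \<Longrightarrow> (\<And>j. j < p \<Longrightarrow> \<bar>x j\<bar> < e) \<Longrightarrow> 1 / 2 \<le> \<psi> x"
    and s: "\<And>k. s k > 0" "s \<longlonglongrightarrow> 0"
    and bounded: "\<And>k. \<bar>\<integral>x. \<psi> (proj p x) * (\<Sum>m\<in>{p<..N}. a m * (cutoff 0 (1 - ((\<Sum>j<p. (x j)\<^sup>2) + s k)) *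
           inverse ((\<Sum>j<p. (x j)\<^sup>2) + s k) ^ m)) \<partial>(leaf_measure p)\<bar> \<le> B"
    and m: "m \<in> {p<..N}"
  shows "a m = 0"
proof (rule ccontr)
  assume "a m \<noteq> 0"
  define M where "M = {m \<in> {p<..N}. a m \<noteq> 0}"
  have M: "finite M" "M \<noteq> {}"
    using m \<open>a m \<noteq> 0\<close> by (auto simp: M_def)
  define d where "d = Max M"
  have d: "d \<in> M" "\<And>i. i \<in> M \<Longrightarrow> i \<le> d"
    using M by (auto simp: d_def)
  \<comment> \<open>The sign makes the leading coefficient positive, so that lower bounds
    suffice.\<close>
  define \<sigma> where "\<sigma> = sgn (a d)"
  have \<sigma>: "\<sigma> * a d = \<bar>a d\<bar>" "\<bar>\<sigma>\<bar> = 1"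
    using d(1) by (auto simp: \<sigma>_def M_def abs_sgn mult.commute)
  define P where "P = (\<lambda>q. \<Sum>m\<in>{p<..N}. a m * (cutoff 0 (1 - q) * inverse q ^ m))"
  \<comment> \<open>\<sigma> P(q) multiplied by q^d: the pole is cleared, and \<open>H\<close> is
    continuous at 0. In \<open>H 0\<close> only the term of order \<open>d\<close> survives, as 0^0
    = 1, so H(0) = 2 c > c.\<close>
  define H where "H = (\<lambda>q. \<sigma> * (cutoff 0 (1 - q) * (\<Sum>m\<in>M. a m * q ^ (d - m))))"
  define c where "c = cutoff 0 1 * \<bar>a d\<bar> / 2"
  have "c > 0"
    using d(1) cutoff_0_bounds(3)[of 1] by (auto simp: c_def M_def)
  have PH: "\<sigma> * P q = H q * inverse q ^ d" if "q > 0" for q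
  proof -
    have "P q = (\<Sum>m\<in>M. a m * (cutoff 0 (1 - q) * inverse q ^ m))"
      unfolding P_def by (rule sum.mono_neutral_right) (auto simp: M_def)
    also have "\<dots> = (\<Sum>m\<in>M. cutoff 0 (1 - q) * (a m * q ^ (d - m)) * inverse q ^ d)"
    proof (rule sum.cong[OF refl])
      fix m assume "m \<in> M"
      then have "inverse q ^ d = inverse q ^ (d - m) * inverse q ^ m"
        using d(2) by (simp add: power_add[symmetric])
      then have "q ^ (d - m) * inverse q ^ d = inverse q ^ m"
        using that by (simp add: power_mult_distrib[symmetric] mult.assoc[symmetric])
      then show "a m * (cutoff 0 (1 - q) * inverse q ^ m) = cutoff 0 (1 - q) * (a m * q ^ (d - m)) * inverse q ^ d"
        by (metis mult.assoc mult.left_commute)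
    qed
    finally show ?thesis
      by (simp add: H_def sum_distrib_left sum_distrib_right mult.assoc)
  qed
  have H0: "H 0 = 2 * c"
  proof -
    have "(\<Sum>m\<in>M. a m * 0 ^ (d - m)) = (\<Sum>m\<in>{d}. a m * 0 ^ (d - m))"
      using d M by (intro sum.mono_neutral_right) force+
    then show ?thesis
      using \<sigma> by (simp add: H_def c_def)
  qed
  have "continuous_on UNIV H"
    unfolding H_def by (intro continuous_intros continuous_on_compose2[OF continuous_on_cutoff[of UNIV]]) auto
  then have "open (H -` {c<..})"
    by (intro open_vimage) auto
  then have "eventually (\<lambda>q. H q > c) (nhds 0)"
    using eventually_nhds_in_open[of "H -` {c<..}" 0] \<open>c > 0\<close> H0 by simp
  then obtain \<delta> where \<delta>: "\<delta> > 0" "\<And>q. \<bar>q\<bar> < \<delta> \<Longrightarrow> H q > c"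
    by (auto simp: eventually_nhds_metric dist_real_def)
  \<comment> \<open>Bounds |P| for q >= \<delta>, since the cutoff lies between 0 and 1 and the
    inverse powers decrease.\<close>
  define b where "b = (\<Sum>m\<in>{p<..N}. \<bar>a m\<bar> * inverse \<delta> ^ m)"
  have Pb: "\<bar>P q\<bar> \<le> b" if "\<delta> \<le> q" for q
    unfolding P_def b_def
  proof (rule order_trans[OF sum_abs], rule sum_mono)
    fix m
    have "0 < q" using that \<delta>(1) by linarith
    then have "inverse q ^ m \<le> inverse \<delta> ^ m"
      using that \<delta>(1) by (intro power_mono le_imp_inverse_le) auto
    then have "cutoff 0 (1 - q) * inverse q ^ m \<le> 1 * inverse \<delta> ^ m"
      using \<open>0 < q\<close> by (intro mult_mono cutoff_0_bounds) auto
    then show "\<bar>a m * (cutoff 0 (1 - q) * inverse q ^ m)\<bar> \<le> \<bar>a m\<bar> * inverse \<delta> ^ m"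
      using \<open>0 < q\<close> cutoff_0_bounds(1) by (simp add: abs_mult mult_left_mono)
  qed
  have "0 \<le> b"
    using Pb[OF order_refl] by linarith
  define A where "A = (\<integral>x. \<psi> (proj p x) \<partial>(leaf_measure p))"
  \<comment> \<open>Obtained by solving the final estimate for 1 / s_k; it does not depend on k,
    which contradicts s_k tending to 0.\<close>
  define R where "R = 2 * (B + b * A) * real (Suc p) ^ d / c"
  have large: "inverse (s k) \<le> R" if k: "s k \<le> 1" "real (Suc p) * s k < \<delta>" "s k < e" for k
  proof -
    let ?q = "\<lambda>x. (\<Sum>j<p. (x j)\<^sup>2) + s k" and ?t = "real (Suc p) * s k"
    \<comment> \<open>The half side is s_k itself: since s_k <= 1, each squared coordinate is at
      most s_k, hence q <= \<open>?t\<close> on the box. There \<psi> >= 1 / 2 and H >= c give the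
      lower bound \<open>?h\<close> for the integrand.\<close>
    let ?X = "Pi\<^sub>E {..<p} (\<lambda>_. {- s k..s k})"
    let ?h = "c / 2 * inverse ?t ^ d"
    have qpos: "?q x > 0" for x :: "nat \<Rightarrow> real"
      using s(1)[of k] by (simp add: add_nonneg_pos sum_nonneg)
    have qproj: "?q (proj p x) = ?q x" for x
      by (simp add: proj_def)
    have "continuous_on (coord_space p) (\<lambda>x. \<psi> x * P (?q x))"
      unfolding P_def using qpos
      by (intro continuous_intros continuous_on_subset[OF \<psi>(1)] continuous_on_compose2[OF continuous_on_cutoff[of UNIV]])
         (auto simp: less_imp_neq[THEN not_sym])
    then have "integrable (leaf_measure p) (\<lambda>x. \<psi> (proj p x) * P (?q (proj p x)))"
      by (rule integrable_compact_support[OF _ D(1,2)]) (simp add: D(3))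
    then have int: "integrable (leaf_measure p) (\<lambda>x. \<psi> (proj p x) * P (?q x))"
      by (simp only: qproj)
    have int\<psi>: "integrable (leaf_measure p) (\<lambda>x. \<psi> (proj p x))"
      by (rule integrable_compact_support[OF continuous_on_subset[OF \<psi>(1)] D(1,2)]) (auto simp: D(3))
    have X: "?X \<in> sets (leaf_measure p)" "emeasure (leaf_measure p) ?X = ennreal ((2 * s k) ^ p)"
      using leaf_box[of "s k" p] s(1)[of k] by auto
    have intX: "integrable (leaf_measure p) (\<lambda>x. ?h * indicator ?X x)"
      using X by (intro integrable_mult_right integrable_real_indicator) auto
    have Xj: "\<bar>x j\<bar> \<le> s k" if "x \<in> ?X" "j < p" for x j
      using that by (auto simp: abs_le_iff PiE_def Pi_def)
    have Xq: "?q x \<le> ?t" if "x \<in> ?X" for x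
    proof -
      have "(\<Sum>j<p. (x j)\<^sup>2) \<le> (\<Sum>j<p. s k)"
      proof (rule sum_mono)
        fix j assume "j \<in> {..<p}"
        then have "(x j)\<^sup>2 \<le> (s k)\<^sup>2"
          using Xj[OF that, of j] s(1)[of k] by (simp add: abs_le_square_iff[symmetric])
        also have "\<dots> \<le> s k"
          using k(1) s(1)[of k] by (simp add: power2_eq_square mult_left_le)
        finally show "(x j)\<^sup>2 \<le> s k" .
      qed
      then show ?thesis
        by (simp add: algebra_simps)
    qed
    \<comment> \<open>In the box the pole gives \<open>?h\<close>; elsewhere with q < \<delta> the
      right side is nonnegative; for q >= \<delta> it is at least -b \<psi>, which accounts for the
      subtracted term.\<close>
    have pointwise: "?h * indicator ?X x - b * \<psi> (proj p x) \<le> \<sigma> * (\<psi> (proj p x) * P (?q x))"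
      if "x \<in> space (leaf_measure p)" for x
    proof (cases "?q x < \<delta>")
      case True
      have Hc: "c \<le> H (?q x)"
        using \<delta>(2)[of "?q x"] True qpos[of x] by simp
      have eq: "\<sigma> * (\<psi> (proj p x) * P (?q x)) = \<psi> (proj p x) * (H (?q x) * inverse (?q x) ^ d)"
        using PH[OF qpos] by (metis mult.left_commute)
      show ?thesis
      proof (cases "x \<in> ?X")
        case True
        then have "inverse ?t ^ d \<le> inverse (?q x) ^ d"
          using Xq[of x] qpos[of x] s(1)[of k] by (intro power_mono le_imp_inverse_le) auto
        then have pole: "c * inverse ?t ^ d \<le> H (?q x) * inverse (?q x) ^ d"
          using Hc \<open>c > 0\<close> s(1)[of k] by (intro mult_mono) auto
        have half: "1 / 2 \<le> \<psi> (proj p x)"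
          using Xj[OF True] k(3) by (intro e(2)) (auto simp: proj_def intro: le_less_trans)
        have "1 / 2 * (c * inverse ?t ^ d) \<le> \<psi> (proj p x) * (H (?q x) * inverse (?q x) ^ d)"
          by (intro mult_mono[OF half pole]) (use \<open>c > 0\<close> s(1)[of k] \<psi>(2) in auto)
        moreover have "0 \<le> b * \<psi> (proj p x)"
          using \<open>0 \<le> b\<close> \<psi>(2) by simp
        ultimately show ?thesis
          using True by (simp add: eq)
      next
        case False
        have "0 \<le> \<psi> (proj p x) * (H (?q x) * inverse (?q x) ^ d)"
          using \<psi>(2) Hc \<open>c > 0\<close> qpos[of x] by (intro mult_nonneg_nonneg) auto
        moreover have "0 \<le> b * \<psi> (proj p x)"
          using \<open>0 \<le> b\<close> \<psi>(2) by simp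
        ultimately show ?thesis
          using False by (simp add: eq)
      qed
    next
      case False
      then have "x \<notin> ?X"
        using Xq[of x] k(2) by linarith
      have "\<bar>\<sigma> * (\<psi> (proj p x) * P (?q x))\<bar> \<le> \<psi> (proj p x) * b"
        using \<sigma>(2) \<psi>(2)[of "proj p x"] Pb[of "?q x"] False by (simp add: abs_mult mult_left_mono)
      then show ?thesis
        using \<open>x \<notin> ?X\<close> by (simp add: mult.commute)
    qed
    have "?h * (2 * s k) ^ p - b * A = (\<integral>x. ?h * indicator ?X x - b * \<psi> (proj p x) \<partial>(leaf_measure p))"
      using intX int\<psi> X s(1)[of k] by (simp add: A_def measure_def)
    also have "\<dots> \<le> (\<integral>x. \<sigma> * (\<psi> (proj p x) * P (?q x)) \<partial>(leaf_measure p))"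
      using intX int\<psi> int pointwise by (intro integral_mono) auto
    also have "\<dots> \<le> \<bar>\<integral>x. \<psi> (proj p x) * P (?q x) \<partial>(leaf_measure p)\<bar>"
      using \<sigma>(2) by (simp add: abs_if split: if_splits)
    also have "\<dots> \<le> B"
      using bounded[of k] by (simp add: P_def)
    finally have le: "?h * (2 * s k) ^ p \<le> B + b * A"
      by simp
    \<comment> \<open>The strict inequality leaves one spare factor s_k beyond the volume of the
      box, and this factor yields 1 / s_k <= R.\<close>
    have "p < d"
      using d(1) by (simp add: M_def)
    then have "s k ^ d = s k ^ p * s k ^ (d - p)"
      by (simp add: power_add[symmetric])
    also have "\<dots> \<le> s k ^ p * s k ^ 1"
      using \<open>p < d\<close> k(1) s(1)[of k] by (intro mult_left_mono power_decreasing) auto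
    also have "\<dots> \<le> (2 * s k) ^ p * s k"
      using s(1)[of k] by (simp add: power_mult_distrib)
    finally have "s k ^ d \<le> (2 * s k) ^ p * s k" .
    then have "inverse (s k) \<le> (2 * s k) ^ p * inverse (s k) ^ d"
      using s(1)[of k] by (simp add: field_simps)
    also have "\<dots> = ?h * (2 * s k) ^ p * (2 * real (Suc p) ^ d / c)"
      using \<open>c > 0\<close> by (simp add: field_simps del: of_nat_Suc)
    also have "\<dots> \<le> (B + b * A) * (2 * real (Suc p) ^ d / c)"
      using le \<open>c > 0\<close> by (intro mult_right_mono) auto
    also have "\<dots> = R"
      by (simp add: R_def)
    finally show ?thesis .
  qed
  have "((\<lambda>k. real (Suc p) * s k) \<longlonglongrightarrow> real (Suc p) * 0)"
    by (intro tendsto_intros s)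
  then have "eventually (\<lambda>k. real (Suc p) * s k < \<delta>) sequentially"
    using \<delta>(1) by (intro order_tendstoD(2)[of _ 0]) auto
  moreover have "eventually (\<lambda>k. s k < 1) sequentially" "eventually (\<lambda>k. s k < e) sequentially"
    using s(2) e(1) by (auto intro!: order_tendstoD(2)[of _ 0])
  moreover have "eventually (\<lambda>k. s k < inverse (\<bar>R\<bar> + 1)) sequentially"
    using s(2) by (intro order_tendstoD(2)[of _ 0]) auto
  ultimately have "eventually (\<lambda>k. False) sequentially"
  proof eventually_elim
    case (elim k)
    have "inverse (s k) \<le> R"
      using elim by (intro large) auto
    moreover have "\<bar>R\<bar> + 1 < inverse (s k)"
      using less_imp_inverse_less[OF elim(4) s(1)] by simp
    ultimately show False
      by linarith
  qed
  then show False
    by simp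
qed

section \<open>Charts and their restrictions\<close>

lemma chart_on_inj: "chart_on n M c \<Longrightarrow> inj_on (snd c) (fst c)"
  unfolding chart_on_def
  by (metis homeomorphic_imp_injective_map openin_subset topspace_subtopology_subset)

lemma chart_inv_apply: "chart_on n M c \<Longrightarrow> x \<in> fst c \<Longrightarrow> chart_inv c (snd c x) = x"
  by (simp add: chart_inv_def chart_on_inj)

lemma transition_apply: "chart_on n M c \<Longrightarrow> x \<in> fst c \<Longrightarrow> transition c d (snd c x) = snd d x"
  by (simp add: transition_def chart_inv_apply)

lemma chart_open_image:
  assumes "chart_on n M c" "openin M X" "X \<subseteq> fst c"
  shows "openin (Euclidean_space n) (snd c ` X)"
proof -
  have "openin (subtopology M (fst c)) X"
    using assms(2,3) by (metis inf.absorb1 openin_subtopology_Int)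
  then have "openin (subtopology (Euclidean_space n) (snd c ` fst c)) (snd c ` X)"
    using assms(1) unfolding chart_on_def by (meson homeomorphic_imp_open_map open_map_def)
  then show ?thesis
    using assms(1) unfolding chart_on_def by (meson openin_trans_full)
qed

lemma chart_image_subset: "chart_on n M c \<Longrightarrow> snd c ` fst c \<subseteq> coord_space n"
  unfolding chart_on_def using openin_Euclidean_space_subset by blast

lemma openin_overlap:
  "chart_on n M c \<Longrightarrow> chart_on n M d \<Longrightarrow> openin (Euclidean_space n) (overlap c d)"
  unfolding overlap_def by (rule chart_open_image) (auto simp: chart_on_def)

definition restrict_chart :: "'a chart \<Rightarrow> 'a set \<Rightarrow> 'a chart" where
  "restrict_chart c X = (fst c \<inter> X, snd c)"

lemma restrict_chart_simps [simp]: "fst (restrict_chart c X) = fst c \<inter> X" "snd (restrict_chart c X) = snd c"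
  by (simp_all add: restrict_chart_def)

text \<open>Lets an unrestricted chart count as a restricted one, so that mixed pairs of charts need
  no separate treatment.\<close>

lemma restrict_chart_topspace: "chart_on n M c \<Longrightarrow> restrict_chart c (topspace M) = c"
  unfolding chart_on_def by (metis inf.absorb1 openin_subset prod.collapse restrict_chart_def)

lemma chart_on_restrict:
  assumes c: "chart_on n M c" and X: "openin M X"
  shows "chart_on n M (restrict_chart c X)"
proof -
  have o: "openin M (fst c \<inter> X)"
    using assms by (auto simp: chart_on_def)
  have "homeomorphic_map (subtopology (subtopology M (fst c)) X)
          (subtopology (subtopology (Euclidean_space n) (snd c ` fst c)) (snd c ` (fst c \<inter> X))) (snd c)"
  proof (rule homeomorphic_map_subtopologies)
    show "homeomorphic_map (subtopology M (fst c)) (subtopology (Euclidean_space n) (snd c ` fst c)) (snd c)"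
      using c by (simp add: chart_on_def)
    have "fst c \<subseteq> topspace M"
      using c by (simp add: chart_on_def openin_subset)
    then show "snd c ` (topspace (subtopology M (fst c)) \<inter> X) =
        topspace (subtopology (Euclidean_space n) (snd c ` fst c)) \<inter> snd c ` (fst c \<inter> X)"
      using chart_image_subset[OF c] by (auto simp: topspace_Euclidean_space)
  qed
  moreover have "snd c ` fst c \<inter> snd c ` (fst c \<inter> X) = snd c ` (fst c \<inter> X)"
    by blast
  ultimately have "homeomorphic_map (subtopology M (fst c \<inter> X))
          (subtopology (Euclidean_space n) (snd c ` (fst c \<inter> X))) (snd c)"
    by (simp add: subtopology_subtopology)
  then show ?thesis
    using o chart_open_image[OF c o] by (simp add: chart_on_def)
qed

lemma overlap_restrict_subset: "overlap (restrict_chart c X) (restrict_chart d Y) \<subseteq> overlap c d"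
  by (auto simp: overlap_def)

lemma transition_restrict:
  assumes "chart_on n M c" "openin M X" "z \<in> overlap (restrict_chart c X) (restrict_chart d Y)"
  shows "transition (restrict_chart c X) (restrict_chart d Y) z = transition c d z"
proof -
  obtain x where x: "x \<in> fst c" "x \<in> X" "z = snd c x"
    using assms(3) by (auto simp: overlap_def)
  then show ?thesis
    using transition_apply[OF assms(1), of x d]
      transition_apply[OF chart_on_restrict[OF assms(1,2)], of x "restrict_chart d Y"] by simp
qed

section \<open>Restricted charts belong to the foliation\<close>

lemma iter_partial_cong:
  assumes W: "openin (Euclidean_space n) W" and fg: "\<And>w. w \<in> W \<Longrightarrow> f w = g w"
  shows "set is \<subseteq> {..<n} \<Longrightarrow> x \<in> W \<Longrightarrow> iter_partial is f x = iter_partial is g x"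
proof (induction "is" arbitrary: x)
  case (Cons i "is")
  show ?case
    unfolding iter_partial.simps
    by (rule partial_cong[OF W]) (use Cons in auto)
qed (simp add: fg)

text \<open>The transition map of restricted charts is known to agree with the original one only on
  the smaller overlap, so the set has to shrink and the function to change at the same time.\<close>

lemma has_cont_partial_restrict:
  assumes W': "openin (Euclidean_space n) W'" "W' \<subseteq> W" and fg: "\<And>w. w \<in> W' \<Longrightarrow> f w = g w"
  shows "has_cont_partial W is f \<Longrightarrow> set is \<subseteq> {..<n} \<Longrightarrow> has_cont_partial W' is g"
proof (induction "is")
  case Nil
  then have "continuous_on W' f"
    using W'(2) continuous_on_subset by auto
  then show ?case
    using fg by (simp cong: continuous_on_cong)
next
  case (Cons i "is")
  have eq: "iter_partial is f w = iter_partial is g w" if "w \<in> W'" for w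
    by (rule iter_partial_cong[OF W'(1) fg]) (use that Cons.prems in auto)
  have "(\<lambda>t. iter_partial is g (x(i := t))) differentiable (at (x i))" if "x \<in> W'" for x
  proof -
    have "(\<lambda>t. iter_partial is f (x(i := t))) differentiable (at (x i))"
      using Cons.prems that W'(2) by auto
    then show ?thesis
      by (subst (asm) differentiable_line_cong[OF W'(1) _ that eq]) (use Cons.prems in auto)
  qed
  moreover have "continuous_on W' (iter_partial (i # is) f)"
    using Cons.prems W'(2) continuous_on_subset by auto
  then have "continuous_on W' (iter_partial (i # is) g)"
    by (subst continuous_on_cong[OF refl]) (use iter_partial_cong[OF W'(1) fg Cons.prems(2)] in auto)
  ultimately show ?case
    using Cons by simp
qed

lemma Ck_on_restrict:
  assumes "Ck_on n k W f" "openin (Euclidean_space n) W'" "W' \<subseteq> W" "\<And>w. w \<in> W' \<Longrightarrow> f w = g w"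
  shows "Ck_on n k W' g"
  unfolding Ck_on_def
proof (intro allI impI)
  fix "is" assume *: "set is \<subseteq> {..<n} \<and> enat (length is) \<le> k"
  then have "has_cont_partial W is f"
    using assms(1) by (simp add: Ck_on_def)
  then show "has_cont_partial W' is g"
    using * by (intro has_cont_partial_restrict[OF assms(2-4)]) auto
qed

lemma leafwise_smooth_on_restrict:
  assumes "leafwise_smooth_on p n r W f" "openin (Euclidean_space n) W'" "W' \<subseteq> W" "p \<le> n"
    and "\<And>w. w \<in> W' \<Longrightarrow> f w = g w"
  shows "leafwise_smooth_on p n r W' g"
  using leafwise_smooth_on_cong[OF assms(2,4), of f g] leafwise_smooth_on_subset[OF assms(1,3)] assms(5)
  by blast

lemma admissible_chart_restrict:
  assumes c: "admissible_chart p n r M A c" and X: "openin M X" and "p \<le> n"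
    and A: "\<And>s. s \<in> A \<Longrightarrow> chart_on n M s"
  shows "admissible_chart p n r M A (restrict_chart c X)"
  unfolding admissible_chart_def
proof (intro conjI ballI allI impI)
  let ?c = "restrict_chart c X"
  have cc: "chart_on n M c"
    using c by (simp add: admissible_chart_def)
  show cc': "chart_on n M ?c"
    by (rule chart_on_restrict[OF cc X])
  fix s assume s: "s \<in> A"
  note sc = A[OF s]
  have O: "openin (Euclidean_space n) (overlap ?c s)" "overlap ?c s \<subseteq> overlap c s"
      "openin (Euclidean_space n) (overlap s ?c)" "overlap s ?c \<subseteq> overlap s c"
    using openin_overlap[OF cc' sc] openin_overlap[OF sc cc'] by (auto simp: overlap_def)
  have T: "transition ?c s z = transition c s z" if "z \<in> overlap ?c s" for z
    using transition_restrict[OF cc X, of z s "topspace M"] that restrict_chart_topspace[OF sc] by simp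
  have T': "transition s ?c z = transition s c z" if "z \<in> overlap s ?c" for z
    using transition_restrict[OF sc openin_topspace, of z c X] that restrict_chart_topspace[OF sc] by simp
  show "leafwise_smooth_on p n r (overlap ?c s) (\<lambda>z. transition ?c s z i)" if "i < n" for i
    by (rule leafwise_smooth_on_restrict[of _ _ _ "overlap c s" "\<lambda>z. transition c s z i"])
       (use c s that O T \<open>p \<le> n\<close> in \<open>auto simp: admissible_chart_def\<close>)
  show "Ck_on n r (overlap s ?c) (\<lambda>z. transition s ?c z i)" if "i < n" for i
    by (rule Ck_on_restrict[of _ _ "overlap s c" "\<lambda>z. transition s c z i"])
       (use c s that O T' in \<open>auto simp: admissible_chart_def\<close>)
  fix z v j
  assume z: "z \<in> overlap ?c s" and "j < p"
    and v: "\<forall>i<n. (\<Sum>j<p. v j * partial j (\<lambda>w. transition ?c s w i) z) = 0"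
  have "partial j (\<lambda>w. transition ?c s w i) z = partial j (\<lambda>w. transition c s w i) z" if "j < p" for i j
    by (rule partial_cong[OF O(1)]) (use that \<open>p \<le> n\<close> z T in auto)
  then have "\<forall>i<n. (\<Sum>j<p. v j * partial j (\<lambda>w. transition c s w i) z) = 0"
    using v by (metis (no_types, lifting) lessThan_iff sum.cong)
  then show "v j = 0"
    using c s z O(2) \<open>j < p\<close> unfolding admissible_chart_def by blast
qed

lemma foliated_transition_restrict:
  assumes cd: "foliated_transition p n r c d" and c: "chart_on n M c" and d: "chart_on n M d"
    and X: "openin M X" and Y: "openin M Y" and "p \<le> n"
  shows "foliated_transition p n r (restrict_chart c X) (restrict_chart d Y)"
proof -
  let ?c = "restrict_chart c X" and ?d = "restrict_chart d Y"
  have O: "openin (Euclidean_space n) (overlap ?c ?d)"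
    by (rule openin_overlap[OF chart_on_restrict[OF c X] chart_on_restrict[OF d Y]])
  note T = transition_restrict[OF c X]
  show ?thesis
    unfolding foliated_transition_def
  proof (intro conjI allI impI ballI)
    show "leafwise_smooth_on p n r (overlap ?c ?d) (\<lambda>z. transition ?c ?d z i)" if "i < n" for i
      using cd that T
      by (intro leafwise_smooth_on_restrict[OF _ O overlap_restrict_subset \<open>p \<le> n\<close>,
            of r "\<lambda>z. transition c d z i"]) (auto simp: foliated_transition_def)
    fix z assume z: "z \<in> overlap ?c ?d"
    then have "z \<in> overlap c d"
      using overlap_restrict_subset by blast
    then obtain W where W: "openin (Euclidean_space n) W" "z \<in> W" "W \<subseteq> overlap c d"
      "\<forall>u\<in>W. \<forall>w\<in>W. (\<forall>i\<in>{p..<n}. u i = w i) \<longrightarrow>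
         (\<forall>i\<in>{p..<n}. transition c d u i = transition c d w i)"
      using cd[unfolded foliated_transition_def, THEN conjunct2, THEN bspec] by metis
    show "\<exists>W. openin (Euclidean_space n) W \<and> z \<in> W \<and> W \<subseteq> overlap ?c ?d \<and>
        (\<forall>u\<in>W. \<forall>w\<in>W. (\<forall>i\<in>{p..<n}. u i = w i) \<longrightarrow>
           (\<forall>i\<in>{p..<n}. transition ?c ?d u i = transition ?c ?d w i))"
    proof (intro exI[of _ "W \<inter> overlap ?c ?d"] conjI)
      show "openin (Euclidean_space n) (W \<inter> overlap ?c ?d)"
        using W(1) O by blast
      show "\<forall>u\<in>W \<inter> overlap ?c ?d. \<forall>w\<in>W \<inter> overlap ?c ?d. (\<forall>i\<in>{p..<n}. u i = w i) \<longrightarrow>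
           (\<forall>i\<in>{p..<n}. transition ?c ?d u i = transition ?c ?d w i)"
        using W(4) T by (metis IntE)
    qed (use z W in auto)
  qed
qed

text \<open>Adding the restricted chart to \<open>F\<close> gives a foliated atlas again, so it was
  there already by maximality. This supplies the induced foliation, which retains only charts of
  \<open>F\<close>, with the part of a chart outside \<open>K\<close>.\<close>

lemma restrict_chart_in_foliation:
  assumes F: "foliation p n r M A F" and A: "\<And>s. s \<in> A \<Longrightarrow> chart_on n M s"
    and c: "c \<in> F" and X: "openin M X"
  shows "restrict_chart c X \<in> F"
proof -
  let ?F = "insert (restrict_chart c X) F"
  have atlas: "foliated_atlas p n r M A F"
    using F by (simp add: foliation_def)
  then have "p \<le> n" and adm: "\<And>d. d \<in> F \<Longrightarrow> admissible_chart p n r M A d"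
    and trans: "\<And>d e. d \<in> F \<Longrightarrow> e \<in> F \<Longrightarrow> foliated_transition p n r d e"
    by (auto simp: foliated_atlas_def)
  then have chart: "\<And>d. d \<in> F \<Longrightarrow> chart_on n M d"
    by (simp add: admissible_chart_def)
  \<comment> \<open>Old charts are restrictions to the whole space; thus every chart or pair of
    charts in the enlarged atlas is covered by one statement about restrictions.\<close>
  have restr: "\<exists>e\<in>F. \<exists>Y. openin M Y \<and> d = restrict_chart e Y" if "d \<in> ?F" for d
    using that c X restrict_chart_topspace[OF chart] by (metis insertE openin_topspace)
  have "foliated_atlas p n r M A ?F"
    unfolding foliated_atlas_def
  proof (intro conjI ballI)
    show "p \<le> n" by fact
    show "admissible_chart p n r M A d" if d: "d \<in> ?F" for d
      using restr[OF d] admissible_chart_restrict[OF adm _ \<open>p \<le> n\<close> A] by blast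
    show "foliated_transition p n r d e" if d: "d \<in> ?F" and e: "e \<in> ?F" for d e
      using restr[OF d] restr[OF e] foliated_transition_restrict[OF trans chart chart _ _ \<open>p \<le> n\<close>] by blast
    show "\<Union> (fst ` ?F) = topspace M"
      using atlas c by (auto simp: foliated_atlas_def)
  qed
  then show ?thesis
    using F unfolding foliation_def by blast
qed

section \<open>Leafwise tangent vectors\<close>

text \<open>Covering the space is left out on purpose: the charts of the induced foliation cover the
  complement of \<open>K\<close>, while \<open>M\<close> stays the ambient topology.\<close>

locale foliated_charts =
  fixes p n :: nat and r :: enat and M :: "'a topology" and F :: "'a chart set"
  assumes chart: "c \<in> F \<Longrightarrow> chart_on n M c"
    and trans: "c \<in> F \<Longrightarrow> d \<in> F \<Longrightarrow> foliated_transition p n r c d"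
    and leaf_dim_le: "p \<le> n"
begin

lemma transition_smooth:
  "c \<in> F \<Longrightarrow> d \<in> F \<Longrightarrow> i < n \<Longrightarrow> leafwise_smooth_on p n r (overlap c d) (\<lambda>z. transition c d z i)"
  using trans by (auto simp: foliated_transition_def)

text \<open>The cocycle identity of the leafwise Jacobians. The sum stops at \<open>p\<close>
  because a motion along a leaf coordinate of \<open>c\<close> keeps the transverse coordinates of
  \<open>c'\<close> locally constant.\<close>

lemma partial_transition_chain:
  assumes F: "c \<in> F" "c' \<in> F" "d \<in> F" and x: "x \<in> fst c" "x \<in> fst c'" "x \<in> fst d"
    and "k < p" "j < n"
  shows "partial k (\<lambda>z. transition c d z j) (snd c x) =
    (\<Sum>i<p. partial i (\<lambda>z. transition c' d z j) (snd c' x) * partial k (\<lambda>z. transition c c' z i) (snd c x))"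
proof -
  let ?z = "snd c x"
  let ?G = "\<lambda>z. transition c' d z j"
  let ?\<gamma> = "\<lambda>t. transition c c' (?z(k := t))"
  have "k < n"
    using \<open>k < p\<close> leaf_dim_le by simp
  have z: "?z \<in> overlap c c'"
    using x by (auto simp: overlap_def)
  have \<gamma>z: "?\<gamma> (?z k) = snd c' x"
    using transition_apply[OF chart] F x by simp
  have G: "leafwise_smooth_on p n r (overlap c' d) ?G"
    using transition_smooth F \<open>j < n\<close> by blast
  have "((\<lambda>t. ?G (?\<gamma> t)) has_real_derivative
      (\<Sum>i<p. partial i ?G (?\<gamma> (?z k)) * partial k (\<lambda>z. transition c c' z i) ?z)) (at (?z k))"
  proof (rule DERIV_compose_partials[of n "overlap c' d"])
    show "openin (Euclidean_space n) (overlap c' d)"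
      using openin_overlap chart F by blast
    show "?\<gamma> (?z k) \<in> overlap c' d"
      using \<gamma>z x by (auto simp: overlap_def)
    show "p \<le> n"
      by (rule leaf_dim_le)
    show "((\<lambda>t. ?G (x(i := t))) has_real_derivative partial i ?G x) (at (x i))"
      if "i < p" "x \<in> overlap c' d" for i x
      by (rule leafwise_smooth_on_DERIV[OF G that])
    show "continuous_on (overlap c' d) (partial i ?G)" if "i < p" for i
      using leafwise_smooth_on_partial[OF G that] by (rule leafwise_smooth_on_continuous)
    show "((\<lambda>t. ?\<gamma> t i) has_real_derivative partial k (\<lambda>z. transition c c' z i) ?z) (at (?z k))"
      if "i < p" for i
      using that leaf_dim_le F \<open>k < p\<close> z
      by (intro leafwise_smooth_on_DERIV[of p n r "overlap c c'"] transition_smooth) auto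
    obtain W where W: "openin (Euclidean_space n) W" "?z \<in> W" "W \<subseteq> overlap c c'"
      "\<forall>u\<in>W. \<forall>w\<in>W. (\<forall>i\<in>{p..<n}. u i = w i) \<longrightarrow>
         (\<forall>i\<in>{p..<n}. transition c c' u i = transition c c' w i)"
      using trans[OF F(1,2), unfolded foliated_transition_def, THEN conjunct2, THEN bspec, OF z] by metis
    \<comment> \<open>The chain rule asks for constancy of all coordinates from \<open>p\<close> on;
      those from \<open>n\<close> on are 0 as chart images lie in the coordinate space.\<close>
    have cs: "transition c c' w i = 0" if "w \<in> overlap c c'" "n \<le> i" for w i
    proof -
      obtain u where u: "u \<in> fst c" "u \<in> fst c'" "w = snd c u"
        using \<open>w \<in> overlap c c'\<close> by (auto simp: overlap_def)
      then have "transition c c' w \<in> coord_space n"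
        using chart_image_subset[OF chart[OF F(2)]] transition_apply[OF chart[OF F(1)] u(1)] by auto
      then show ?thesis
        using \<open>n \<le> i\<close> by simp
    qed
    show "eventually (\<lambda>t. \<forall>i\<ge>p. ?\<gamma> t i = ?\<gamma> (?z k) i) (nhds (?z k))"
      using eventually_update_in[OF W(1) \<open>k < n\<close> W(2)]
    proof eventually_elim
      case (elim t)
      have *: "\<forall>i\<in>{p..<n}. ?\<gamma> t i = transition c c' ?z i"
        by (rule W(4)[THEN bspec, OF elim, THEN bspec, OF W(2), THEN mp]) (use \<open>k < p\<close> in auto)
      have "?\<gamma> t i = transition c c' ?z i" if "p \<le> i" for i
      proof (cases "i < n")
        case False
        then show ?thesis
          using cs elim W(3) z by (metis not_less subset_iff)
      qed (use * that in auto)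
      then show ?case by simp
    qed
  qed
  \<comment> \<open>Near the point all three charts are defined, so the direct transition is the
    composite of the other two.\<close>
  moreover have "eventually (\<lambda>t. ?z(k := t) \<in> snd c ` (fst c \<inter> fst c' \<inter> fst d)) (nhds (?z k))"
  proof (rule eventually_update_in[OF _ \<open>k < n\<close>])
    show "openin (Euclidean_space n) (snd c ` (fst c \<inter> fst c' \<inter> fst d))"
    proof (rule chart_open_image[OF chart[OF F(1)]])
      have "openin M (fst c)" "openin M (fst c')" "openin M (fst d)"
        using chart F by (simp_all add: chart_on_def)
      then show "openin M (fst c \<inter> fst c' \<inter> fst d)"
        by blast
    qed auto
  qed (use x in auto)
  then have "eventually (\<lambda>t. transition c d (?z(k := t)) j = ?G (?\<gamma> t)) (nhds (?z k))"
  proof eventually_elim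
    case (elim t)
    then obtain w where w: "w \<in> fst c" "w \<in> fst c'" "w \<in> fst d" "?z(k := t) = snd c w"
      by auto
    then show ?case
      using transition_apply[OF chart[OF F(1)] w(1)] transition_apply[OF chart[OF F(2)] w(2)] by simp
  qed
  ultimately have "((\<lambda>t. transition c d (?z(k := t)) j) has_real_derivative
      (\<Sum>i<p. partial i ?G (?\<gamma> (?z k)) * partial k (\<lambda>z. transition c c' z i) ?z)) (at (?z k))"
    by (subst DERIV_cong_ev[OF refl _ refl, of _ "\<lambda>t. ?G (?\<gamma> t)"]) auto
  then show ?thesis
    using \<gamma>z by (simp add: partial_eqI)
qed

text \<open>The compatibility demanded of tangent vectors is here exactly the cocycle
  identity.\<close>

lemma coord_vector_tangent:
  assumes "c \<in> F" "x \<in> fst c" "i < p"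
  shows "coord_vector p F c x i \<in> leaf_tangent_space p F x"
  unfolding leaf_tangent_space_def
proof (intro CollectI conjI ballI allI impI)
  show "coord_vector p F c x i d j = 0" if "d \<notin> F \<or> x \<notin> fst d \<or> p \<le> j" for d j
    using that by (auto simp: coord_vector_def)
  fix c' d j assume *: "c' \<in> F" "d \<in> F" "x \<in> fst c' \<and> x \<in> fst d" "j < p"
  then have "j < n"
    using leaf_dim_le by simp
  have "coord_vector p F c x i d j = partial i (\<lambda>z. transition c d z j) (snd c x)"
    using * by (simp add: coord_vector_def)
  also have "\<dots> = (\<Sum>l<p. partial l (\<lambda>z. transition c' d z j) (snd c' x) *
      partial i (\<lambda>z. transition c c' z l) (snd c x))"
    by (rule partial_transition_chain) (use * assms \<open>j < n\<close> in auto)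
  also have "\<dots> = (\<Sum>l<p. partial l (\<lambda>z. transition c' d z j) (snd c' x) * coord_vector p F c x i c' l)"
    using * by (intro sum.cong) (auto simp: coord_vector_def)
  finally show "coord_vector p F c x i d j =
      (\<Sum>l<p. partial l (\<lambda>z. transition c' d z j) (snd c' x) * coord_vector p F c x i c' l)" .
qed

lemma coord_vector_self:
  assumes "c \<in> F" "x \<in> fst c" "i < p" "j < p"
  shows "coord_vector p F c x i c j = (if i = j then 1 else 0)"
proof -
  let ?z = "snd c x"
  have "openin (Euclidean_space n) (snd c ` fst c)"
    using chart assms(1) by (simp add: chart_on_def)
  then have "partial i (\<lambda>z. transition c c z j) ?z = partial i (\<lambda>z. z j) ?z"
    by (rule partial_cong) (use assms leaf_dim_le in \<open>auto simp: transition_apply[OF chart[OF assms(1)]]\<close>)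
  also have "\<dots> = (if i = j then 1 else 0)"
    by (rule partial_eqI) (auto intro!: derivative_eq_intros)
  finally show ?thesis
    using assms by (simp add: coord_vector_def)
qed

end

lemma leaf_tangent_space_lincomb:
  assumes "u \<in> leaf_tangent_space p F x" "w \<in> leaf_tangent_space p F x"
  shows "(\<lambda>c i. a * u c i + b * w c i) \<in> leaf_tangent_space p F x"
  unfolding leaf_tangent_space_def
proof (intro CollectI conjI ballI allI impI)
  show "a * u c i + b * w c i = 0" if "c \<notin> F \<or> x \<notin> fst c \<or> p \<le> i" for c i
  proof -
    have "u c i = 0" "w c i = 0"
      using assms that unfolding leaf_tangent_space_def by blast+
    then show ?thesis
      by simp
  qed
  fix c d j assume *: "c \<in> F" "d \<in> F" "x \<in> fst c \<and> x \<in> fst d" "j < p"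
  let ?J = "\<lambda>i. partial i (\<lambda>z. transition c d z j) (snd c x)"
  have "u d j = (\<Sum>i<p. ?J i * u c i)" "w d j = (\<Sum>i<p. ?J i * w c i)"
    using assms * unfolding leaf_tangent_space_def by blast+
  then show "a * u d j + b * w d j = (\<Sum>i<p. ?J i * (a * u c i + b * w c i))"
    by (simp add: sum_distrib_left sum.distrib algebra_simps)
qed

section \<open>Top-degree forms supported in a chart\<close>

text \<open>The Leibniz formula for matrices whose size \<open>p\<close> is a term rather than a
  type; the first argument of \<open>A\<close> is the row.\<close>

definition leaf_det :: "nat \<Rightarrow> (nat \<Rightarrow> nat \<Rightarrow> real) \<Rightarrow> real" where
  "leaf_det p A = (\<Sum>\<pi> | \<pi> permutes {..<p}. of_int (sign \<pi>) * (\<Prod>a<p. A a (\<pi> a)))"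

lemma leaf_det_cong:
  "(\<And>a b. a < p \<Longrightarrow> b < p \<Longrightarrow> A a b = B a b) \<Longrightarrow> leaf_det p A = leaf_det p B"
  unfolding leaf_det_def
  by (intro sum.cong refl arg_cong2[of _ _ _ _ "(*)"] prod.cong) (auto dest: permutes_in_image)

lemma leaf_det_linear:
  assumes "l < p"
  shows "leaf_det p (A(l := (\<lambda>j. s * u j + t * w j))) = s * leaf_det p (A(l := u)) + t * leaf_det p (A(l := w))"
proof -
  have "(\<Prod>a<p. (A(l := v)) a (\<pi> a)) = v (\<pi> l) * (\<Prod>a\<in>{..<p} - {l}. A a (\<pi> a))" for v \<pi>
    using assms by (subst prod.remove[of _ l]) auto
  then show ?thesis
    unfolding leaf_det_def by (simp add: sum_distrib_left sum.distrib[symmetric] algebra_simps)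
qed

text \<open>Composing each permutation with the transposition of the two rows flips its sign and
  leaves the product unchanged, so the determinant equals its own negative.\<close>

lemma leaf_det_identical_rows:
  assumes "l < m" "m < p" "A l = A m"
  shows "leaf_det p A = 0"
proof -
  let ?\<tau> = "Transposition.transpose l m"
  let ?f = "\<lambda>\<pi>. of_int (sign \<pi>) * (\<Prod>a<p. A a (\<pi> a)) :: real"
  have \<tau>: "?\<tau> permutes {..<p}"
    using assms by (intro permutes_swap_id) auto
  have "leaf_det p A = (\<Sum>\<pi> | \<pi> permutes {..<p}. ?f (\<pi> \<circ> ?\<tau>))"
    unfolding leaf_det_def by (rule sum_permutations_compose_right[OF \<tau>])
  also have "\<dots> = (\<Sum>\<pi> | \<pi> permutes {..<p}. - ?f \<pi>)"
  proof (rule sum.cong[OF refl])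
    fix \<pi> assume "\<pi> \<in> {\<pi>. \<pi> permutes {..<p}}"
    then have "permutation \<pi>" "permutation ?\<tau>"
      using \<tau> permutation_permutes by (auto intro: permutes_imp_permutation)
    then have "sign (\<pi> \<circ> ?\<tau>) = - sign \<pi>"
      using assms by (simp add: sign_compose sign_swap_id)
    moreover have "(\<Prod>a<p. A a ((\<pi> \<circ> ?\<tau>) a)) = (\<Prod>a<p. A (?\<tau> a) (\<pi> a))"
      using prod.permute[OF \<tau>, of "\<lambda>a. A a (\<pi> (?\<tau> a))"] by (simp add: o_def)
    moreover have "A (?\<tau> a) = A a" for a
      using assms(3) by (auto simp: Transposition.transpose_def)
    ultimately show "?f (\<pi> \<circ> ?\<tau>) = - ?f \<pi>"
      by simp
  qed
  also have "\<dots> = - leaf_det p A"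
    by (simp add: leaf_det_def sum_negf)
  finally show ?thesis by simp
qed

lemma leaf_det_id:
  "leaf_det p (\<lambda>a b. if a = b then 1 else 0) = 1"
proof -
  have "(\<Prod>a<p. if a = \<pi> a then 1 else 0) = (0::real)" if "\<pi> permutes {..<p}" "\<pi> \<noteq> id" for \<pi>
  proof -
    obtain a where "\<pi> a \<noteq> a"
      using \<open>\<pi> \<noteq> id\<close> by (auto simp: fun_eq_iff)
    moreover from this have "a < p"
      using that(1) by (metis lessThan_iff permutes_not_in)
    ultimately have "\<exists>a\<in>{..<p}. (if a = \<pi> a then 1 else 0) = (0::real)"
      by (intro bexI[of _ a]) auto
    then show ?thesis
      by (intro prod_zero) auto
  qed
  then have "leaf_det p (\<lambda>a b. if a = b then 1 else 0) =
      (\<Sum>\<pi>\<in>{id}. of_int (sign \<pi>) * (\<Prod>a<p. if a = \<pi> a then 1 else 0))"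
    unfolding leaf_det_def
    by (intro sum.mono_neutral_right) (auto simp: finite_permutations permutes_id)
  then show ?thesis
    by simp
qed

text \<open>The form f dz_1 ... dz_p of the chart \<open>c\<close>, extended by 0. A tangent vector
  carries its coordinates in every chart, so its \<open>c\<close>-coordinates can be inserted into
  the determinant directly.\<close>

definition top_form :: "nat \<Rightarrow> 'a chart set \<Rightarrow> 'a chart \<Rightarrow> ('a \<Rightarrow> real) \<Rightarrow> 'a form" where
  "top_form p F c f = (\<lambda>x vs.
     if x \<in> fst c \<and> length vs = p \<and> set vs \<subseteq> leaf_tangent_space p F x
     then f x * leaf_det p (\<lambda>a. (vs ! a) c) else 0)"

lemma top_form_alternating:
  assumes "c \<in> F"
  shows "alternating_form p F p (top_form p F c f)"
  unfolding alternating_form_def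
proof (intro conjI allI impI ballI)
  show "top_form p F c f x vs = 0"
    if "\<not> (x \<in> \<Union> (fst ` F) \<and> length vs = p \<and> set vs \<subseteq> leaf_tangent_space p F x)" for x vs
    using that assms by (auto simp: top_form_def)
next
  fix x vs l u w a b
  assume vs: "length vs = p \<and> set vs \<subseteq> leaf_tangent_space p F x" and "l < p"
    and u: "u \<in> leaf_tangent_space p F x" and w: "w \<in> leaf_tangent_space p F x"
  have det: "leaf_det p (\<lambda>i. (vs[l := v] ! i) c) = leaf_det p ((\<lambda>i. (vs ! i) c)(l := v c))" for v
    using vs \<open>l < p\<close> by (intro leaf_det_cong) (auto simp: nth_list_update)
  have set: "set (vs[l := v]) \<subseteq> leaf_tangent_space p F x" if "v \<in> leaf_tangent_space p F x" for v
    using vs that set_update_subset_insert by fastforce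
  show "top_form p F c f x (vs[l := (\<lambda>c i. a * u c i + b * w c i)]) =
      a * top_form p F c f x (vs[l := u]) + b * top_form p F c f x (vs[l := w])"
    using set[OF u] set[OF w] set[OF leaf_tangent_space_lincomb[OF u w]] vs \<open>l < p\<close>
    by (simp add: top_form_def det leaf_det_linear algebra_simps)
next
  fix x vs l m
  assume "length vs = p \<and> set vs \<subseteq> leaf_tangent_space p F x" "l < m \<and> m < p \<and> vs ! l = vs ! m"
  then show "top_form p F c f x vs = 0"
    using leaf_det_identical_rows[of l m p "\<lambda>a. (vs ! a) c"] by (simp add: top_form_def)
qed

text \<open>Vacuous: there is no strictly increasing list of p + 1 indices below
  \<open>p\<close>.\<close>

lemma top_degree_closed: "has_leafwise_d p F p \<omega> \<eta>"
proof -
  have False if "length is = Suc p" "set is \<subseteq> {..<p}" "sorted_wrt (<) is" for "is" :: "nat list"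
  proof -
    have "card (set is) = Suc p"
      using that(1,3) strict_sorted_iff distinct_card by metis
    then show False
      using card_mono[OF _ that(2)] by simp
  qed
  then show ?thesis
    unfolding has_leafwise_d_def by blast
qed

context foliated_charts
begin

text \<open>The transformation rule of top-degree forms: changing the chart produces the leafwise
  Jacobian determinant, with its rows selected by \<open>is\<close>.\<close>

lemma form_coeff_top_form:
  assumes c: "c \<in> F" and d: "d \<in> F" and x: "x \<in> fst d" and "is": "length is = p" "set is \<subseteq> {..<p}"
  shows "form_coeff p F (top_form p F c f) d is (snd d x) =
    (if x \<in> fst c then f x * leaf_det p (\<lambda>a b. partial (is ! a) (\<lambda>z. transition d c z b) (snd d x)) else 0)"
proof -
  have "chart_inv d (snd d x) = x"
    by (rule chart_inv_apply[OF chart[OF d] x])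
  moreover have "set (map (coord_vector p F d x) is) \<subseteq> leaf_tangent_space p F x"
    using coord_vector_tangent[OF d x] "is"(2) by auto
  moreover have "leaf_det p (\<lambda>a. (map (coord_vector p F d x) is ! a) c) =
      leaf_det p (\<lambda>a b. partial (is ! a) (\<lambda>z. transition d c z b) (snd d x))" if "x \<in> fst c"
    by (rule leaf_det_cong) (use c that "is"(1) in \<open>auto simp: coord_vector_def\<close>)
  ultimately show ?thesis
    using "is"(1) by (simp add: form_coeff_def top_form_def)
qed

lemma form_coeff_top_form_self:
  assumes "c \<in> F" "x \<in> fst c"
  shows "form_coeff p F (top_form p F c f) c [0..<p] (snd c x) = f x"
proof -
  have "leaf_det p (\<lambda>a b. partial ([0..<p] ! a) (\<lambda>z. transition c c z b) (snd c x)) =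
      leaf_det p (\<lambda>a b. if a = b then 1 else 0)"
    using coord_vector_self[OF assms] assms
    by (intro leaf_det_cong) (auto simp: coord_vector_def split: if_splits)
  then show ?thesis
    using form_coeff_top_form[OF assms(1,1,2), of "[0..<p]" f] assms by (simp add: leaf_det_id atLeast_upt)
qed

text \<open>A chart \<open>d\<close> is covered by two open sets: its overlap with \<open>c\<close>,
  where the coefficient is an explicit smooth expression, and the complement of \<open>Q\<close>,
  where it vanishes. That they cover \<open>d\<close> is the third condition on \<open>Q\<close>; it
  concerns only the charts in \<open>F\<close>, so \<open>Q\<close> itself may reach points outside
  all of them.\<close>

lemma top_form_leafwise:
  assumes c: "c \<in> F" and Q: "closedin M Q" "\<And>x. x \<in> fst c - Q \<Longrightarrow> f x = 0"
    "\<And>d. d \<in> F \<Longrightarrow> fst d \<inter> Q \<subseteq> fst c"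
    and f: "\<And>d. d \<in> F \<Longrightarrow> leafwise_smooth_on p n r (overlap d c) (\<lambda>z. f (chart_inv d z))"
  shows "top_form p F c f \<in> leafwise_forms p n r F p"
  unfolding leafwise_forms_def
proof (intro CollectI conjI ballI allI impI top_form_alternating c)
  fix d "is" assume d: "d \<in> F" and "is": "length is = p \<and> set is \<subseteq> {..<p}"
  let ?g = "form_coeff p F (top_form p F c f) d is"
  have g: "?g (snd d x) =
    (if x \<in> fst c then f x * leaf_det p (\<lambda>a b. partial (is ! a) (\<lambda>z. transition d c z b) (snd d x)) else 0)"
    if "x \<in> fst d" for x
    using form_coeff_top_form c d that "is" by blast
  note dc = chart[OF d]
  show "leafwise_smooth_on p n r (snd d ` fst d) ?g"
  proof (rule leafwise_smooth_on_local[OF chart_image_subset[OF dc]])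
    fix z assume "z \<in> snd d ` fst d"
    then obtain x where x: "x \<in> fst d" "z = snd d x"
      by blast
    show "\<exists>W. openin (Euclidean_space n) W \<and> z \<in> W \<and> leafwise_smooth_on p n r W ?g"
    proof (cases "x \<in> fst c")
      case True
      have O: "openin (Euclidean_space n) (overlap d c)"
        using openin_overlap dc chart[OF c] by blast
      let ?h = "\<lambda>z. f (chart_inv d z) * leaf_det p (\<lambda>a b. partial (is ! a) (\<lambda>z. transition d c z b) z)"
      have "leafwise_smooth_on p n r (overlap d c) ?h"
        unfolding leaf_det_def
      proof (intro leafwise_smooth_on_mult[OF O leaf_dim_le] leafwise_smooth_on_sum[OF O leaf_dim_le]
          leafwise_smooth_on_prod[OF O leaf_dim_le] leafwise_smooth_on_const[OF O leaf_dim_le] f[OF d]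
          leafwise_smooth_on_partial transition_smooth[OF d c])
        show "finite {\<pi>. \<pi> permutes {..<p}}"
          by (simp add: finite_permutations)
        fix \<pi> a assume "\<pi> \<in> {\<pi>. \<pi> permutes {..<p}}" and a: "a \<in> {..<p}"
        then have "\<pi> a < p"
          using permutes_in_image[of \<pi> "{..<p}" a] by simp
        then show "\<pi> a < n"
          using leaf_dim_le by simp
        show "is ! a < p"
          using "is" a nth_mem by fastforce
      qed auto
      moreover have "?g w = ?h w" if "w \<in> overlap d c" for w
        using that g chart_inv_apply[OF dc] by (auto simp: overlap_def)
      ultimately have "leafwise_smooth_on p n r (overlap d c) ?g"
        using leafwise_smooth_on_cong[OF O leaf_dim_le, of ?g ?h r] by simp
      then show ?thesis
        using O x True by (intro exI[of _ "overlap d c"]) (auto simp: overlap_def)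
    next
      case False
      let ?W = "snd d ` (fst d - Q)"
      have O: "openin (Euclidean_space n) ?W"
        using Q(1) dc by (intro chart_open_image[OF dc]) (auto simp: chart_on_def)
      have "?g w = 0" if "w \<in> ?W" for w
        using that g Q(2) by auto
      then have "leafwise_smooth_on p n r ?W ?g"
        using leafwise_smooth_on_cong[OF O leaf_dim_le, of ?g "\<lambda>_. 0" r]
          leafwise_smooth_on_const[OF O leaf_dim_le] by simp
      moreover have "z \<in> ?W"
        using Q(3)[OF d] x False by blast
      ultimately show ?thesis
        using O by blast
    qed
  qed
qed

end

section \<open>Exact forms have bounded pairings\<close>

text \<open>The top coefficient of an exact form is an alternating sum of leafwise derivatives of
  the coefficients of its primitive, and each summand pairs boundedly with \<psi>.\<close>

lemma (in foliated_charts) exact_pairing_bounded: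
  fixes \<psi> :: "(nat \<Rightarrow> real) \<Rightarrow> real" and d\<psi> :: "nat \<Rightarrow> (nat \<Rightarrow> real) \<Rightarrow> real"
  assumes c: "c \<in> F"
    and S: "openin (Euclidean_space p) S"
    and D: "compact D" "D \<subseteq> S" "\<And>x. x \<in> coord_space p - D \<Longrightarrow> \<psi> x = 0"
    and C: "compact C" "C \<subseteq> D" "\<And>x l. x \<in> coord_space p - C \<Longrightarrow> d\<psi> l x = 0"
    and \<psi>: "continuous_on UNIV \<psi>" and d\<psi>: "\<And>l. continuous_on UNIV (d\<psi> l)"
    and deriv: "\<And>x l. l < p \<Longrightarrow> ((\<lambda>t. \<psi> (x(l := t))) has_real_derivative d\<psi> l x) (at (x l))"
    and y: "y \<longlonglongrightarrow> (\<lambda>_. 0)"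
    and slices: "\<And>x k. x \<in> S \<Longrightarrow> pair_point p x (y k) \<in> snd c ` fst c"
      "\<And>x. x \<in> C \<Longrightarrow> pair_point p x (\<lambda>_. 0) \<in> snd c ` fst c"
    and \<eta>: "\<eta> \<in> exact_forms p n r F p"
  shows "\<exists>B. \<forall>k. \<bar>\<integral>x. \<psi> (proj p x) * form_coeff p F \<eta> c [0..<p] (pair_point p x (y k)) \<partial>(leaf_measure p)\<bar> \<le> B"
proof (cases p)
  \<comment> \<open>There are no forms of degree -1: an exact 0-form is 0 by definition.\<close>
  case 0
  then have "\<eta> = (\<lambda>_ _. 0)"
    using \<eta> by (simp add: exact_forms_def)
  then show ?thesis
    by (auto simp: form_coeff_def)
next
  case (Suc m)
  then obtain \<alpha> where \<alpha>: "\<alpha> \<in> leafwise_forms p n r F m" "has_leafwise_d p F m \<alpha> \<eta>"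
    using \<eta> by (auto simp: exact_forms_def)
  let ?g = "\<lambda>l. form_coeff p F \<alpha> c (take l [0..<p] @ drop (Suc l) [0..<p])"
  let ?I = "\<lambda>l k x. \<psi> (proj p x) * partial l (?g l) (pair_point p x (y k))"
  have g: "leafwise_smooth_on p n r (snd c ` fst c) (?g l)" if "l \<le> m" for l
  proof -
    have "length (take l [0..<p] @ drop (Suc l) [0..<p]) = m"
      using that Suc by simp
    moreover have "set (take l [0..<p] @ drop (Suc l) [0..<p]) \<subseteq> {..<p}"
      using set_take_subset[of l "[0..<p]"] set_drop_subset[of "Suc l" "[0..<p]"] by auto
    ultimately show ?thesis
      using \<alpha>(1) c unfolding leafwise_forms_def by blast
  qed
  have "\<exists>B. \<forall>k. integrable (leaf_measure p) (?I l k) \<and> \<bar>integral\<^sup>L (leaf_measure p) (?I l k)\<bar> \<le> B"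
    if "l \<le> m" for l
  proof -
    have "l < p"
      using \<open>l \<le> m\<close> Suc by simp
    obtain B where "\<And>k. integrable (leaf_measure p) (?I l k)"
      "\<And>k. \<bar>integral\<^sup>L (leaf_measure p) (?I l k)\<bar> \<le> B"
      by (rule leafwise_derivative_pairing_bounded[OF S D C \<psi> d\<psi> deriv y slices g[OF \<open>l \<le> m\<close>] \<open>l < p\<close>]) auto
    then show ?thesis by blast
  qed
  then have "\<forall>l\<in>{..m}. \<exists>B. \<forall>k. integrable (leaf_measure p) (?I l k) \<and>
      \<bar>integral\<^sup>L (leaf_measure p) (?I l k)\<bar> \<le> B"
    by blast
  from bchoice[OF this] obtain B where B: "\<And>l k. l \<le> m \<Longrightarrow> integrable (leaf_measure p) (?I l k)"
    "\<And>l k. l \<le> m \<Longrightarrow> \<bar>integral\<^sup>L (leaf_measure p) (?I l k)\<bar> \<le> B l"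
    by blast
  \<comment> \<open>Outside \<open>S\<close> the slice may leave the chart, but there \<psi>
    vanishes and both sides are 0.\<close>
  have expand: "\<psi> (proj p x) * form_coeff p F \<eta> c [0..<p] (pair_point p x (y k)) =
      (\<Sum>l\<le>m. (- 1) ^ l * ?I l k x)" for k x
  proof (cases "proj p x \<in> S")
    case True
    then have "pair_point p x (y k) \<in> snd c ` fst c"
      using slices(1)[OF True, of k] by simp
    then have "form_coeff p F \<eta> c [0..<p] (pair_point p x (y k)) =
        (\<Sum>l\<le>m. (- 1) ^ l * partial ([0..<p] ! l) (?g l) (pair_point p x (y k)))"
      by (intro \<alpha>(2)[unfolded has_leafwise_d_def, rule_format, OF c]) (use Suc in \<open>auto simp del: upt_Suc\<close>)
    also have "\<dots> = (\<Sum>l\<le>m. (- 1) ^ l * partial l (?g l) (pair_point p x (y k)))"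
      using Suc by (intro sum.cong refl) (simp del: upt_Suc)
    finally show ?thesis
      by (simp add: sum_distrib_left mult.left_commute)
  next
    case False
    then have "\<psi> (proj p x) = 0"
      using D(2) by (intro D(3)) auto
    then show ?thesis by simp
  qed
  show ?thesis
  proof (intro exI allI)
    fix k
    let ?L = "\<integral>x. \<psi> (proj p x) * form_coeff p F \<eta> c [0..<p] (pair_point p x (y k)) \<partial>(leaf_measure p)"
    have "?L = (\<Sum>l\<le>m. (- 1) ^ l * integral\<^sup>L (leaf_measure p) (?I l k))"
      unfolding expand using B(1) by (subst Bochner_Integration.integral_sum) auto
    then have "\<bar>?L\<bar> \<le> (\<Sum>l\<le>m. \<bar>(- 1) ^ l * integral\<^sup>L (leaf_measure p) (?I l k)\<bar>)"
      using sum_abs by (simp only:)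
    also have "\<dots> \<le> (\<Sum>l\<le>m. B l)"
    proof (rule sum_mono)
      fix l assume "l \<in> {..m}"
      have "\<bar>(- 1) ^ l * integral\<^sup>L (leaf_measure p) (?I l k)\<bar> = \<bar>integral\<^sup>L (leaf_measure p) (?I l k)\<bar>"
        unfolding abs_mult power_abs by simp
      also have "\<dots> \<le> B l"
        using \<open>l \<in> {..m}\<close> by (intro B(2)) simp
      finally show "\<bar>(- 1) ^ l * integral\<^sup>L (leaf_measure p) (?I l k)\<bar> \<le> B l" .
    qed
    finally show "\<bar>?L\<bar> \<le> (\<Sum>l\<le>m. B l)" .
  qed
qed

section \<open>Forms with a pole at the origin\<close>

text \<open>The norm includes the transverse coordinates: a pole in the leaf coordinates alone would
  be singular on every slice, whereas this one is singular at a single point.\<close>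

definition pole :: "nat \<Rightarrow> nat \<Rightarrow> (nat \<Rightarrow> real) \<Rightarrow> real" where
  "pole n m z = cutoff 0 (1 - (\<Sum>j<n. (z j)\<^sup>2)) * inverse (\<Sum>j<n. (z j)\<^sup>2) ^ m"

text \<open>Stated for a composite with \<open>u\<close> because other charts see the function
  through their transition maps.\<close>

lemma leafwise_smooth_on_pole:
  assumes W: "openin (Euclidean_space n) W" and "p \<le> n"
    and u: "\<And>j. j < n \<Longrightarrow> leafwise_smooth_on p n r W (\<lambda>z. u z j)"
    and nonzero: "\<And>z. z \<in> W \<Longrightarrow> \<exists>j<n. u z j \<noteq> 0"
  shows "leafwise_smooth_on p n r W (\<lambda>z. pole n m (u z))"
proof -
  let ?q = "\<lambda>z. \<Sum>j<n. (u z j)\<^sup>2"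
  have q: "leafwise_smooth_on p n r W ?q"
    using u by (intro leafwise_smooth_on_sum[OF W \<open>p \<le> n\<close>] leafwise_smooth_on_power[OF W \<open>p \<le> n\<close>]) auto
  have "leafwise_smooth_on p n r W (\<lambda>z. 1 + - 1 * ?q z)"
    by (intro leafwise_smooth_on_add[OF W \<open>p \<le> n\<close>] leafwise_smooth_on_mult[OF W \<open>p \<le> n\<close>]
        leafwise_smooth_on_const[OF W \<open>p \<le> n\<close>] q)
  then have "leafwise_smooth_on p n r W (\<lambda>z. cutoff 0 (1 + - 1 * ?q z))"
    by (rule leafwise_smooth_on_compose[OF W \<open>p \<le> n\<close>, of cutoff, OF DERIV_cutoff])
  moreover have "?q z \<noteq> 0" if "z \<in> W" for z
    using nonzero[OF that] by (subst sum_nonneg_eq_0_iff) auto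
  then have "leafwise_smooth_on p n r W (\<lambda>z. inverse (?q z) ^ m)"
    by (intro leafwise_smooth_on_power[OF W \<open>p \<le> n\<close>] leafwise_smooth_on_inverse[OF W \<open>p \<le> n\<close> q])
  ultimately show ?thesis
    unfolding pole_def using leafwise_smooth_on_mult[OF W \<open>p \<le> n\<close>] by fastforce
qed

lemma pole_eq_0: "1 \<le> (\<Sum>j<n. (z j)\<^sup>2) \<Longrightarrow> pole n m z = 0"
  by (simp add: pole_def cutoff_eq_0)

text \<open>The ball is a closed subset of the cube of all sequences with values in [-1, 1], which
  is compact by Tychonoff.\<close>

lemma compact_unit_ball: "compact {z \<in> coord_space n. (\<Sum>j<n. (z j)\<^sup>2) \<le> 1}"
proof -
  let ?B = "{z \<in> coord_space n. (\<Sum>j<n. (z j)\<^sup>2) \<le> 1}"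
  have "compactin (product_topology (\<lambda>_. euclidean) UNIV) (Pi\<^sub>E UNIV (\<lambda>_::nat. {-1..1::real}))"
    by (simp add: compactin_PiE)
  then have cube: "compact (Pi\<^sub>E UNIV (\<lambda>_::nat. {-1..1::real}))"
    by (simp add: euclidean_product_topology)
  have sub: "?B \<subseteq> Pi\<^sub>E UNIV (\<lambda>_. {-1..1})"
  proof
    fix z assume z: "z \<in> ?B"
    have "\<bar>z j\<bar> \<le> 1" for j
    proof (cases "j < n")
      case True
      then have "(z j)\<^sup>2 \<le> (\<Sum>j<n. (z j)\<^sup>2)"
        by (intro member_le_sum) auto
      then have "(z j)\<^sup>2 \<le> 1"
        using z by auto
      then show ?thesis
        by (simp add: abs_square_le_1)
    qed (use z in auto)
    then show "z \<in> Pi\<^sub>E UNIV (\<lambda>_. {-1..1})"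
      by (auto simp: abs_le_iff minus_le_iff)
  qed
  have "?B = (\<Inter>i\<in>{n..}. {z. z i = 0}) \<inter> {z. (\<Sum>j<n. (z j)\<^sup>2) \<le> 1}"
    by auto
  also have "closed \<dots>"
    by (intro closed_Int closed_INT ballI closed_Collect_le closed_Collect_eq continuous_intros)
  finally have "closed ?B" .
  from compact_Int_closed[OF cube this] show ?thesis
    using sub by (simp only: inf.absorb2)
qed

text \<open>As the chart is onto, its unit ball corresponds to the whole compact ball; being
  compact, it is closed in all of the Hausdorff space \<open>M\<close>, not only in the chart
  domain.\<close>

lemma closedin_chart_unit_ball:
  assumes "Hausdorff_space M" "chart_on n M c" "snd c ` fst c = topspace (Euclidean_space n)"
  shows "closedin M {x \<in> fst c. (\<Sum>j<n. (snd c x j)\<^sup>2) \<le> 1}"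
proof -
  let ?Q = "{x \<in> fst c. (\<Sum>j<n. (snd c x j)\<^sup>2) \<le> 1}"
  have "fst c \<subseteq> topspace M"
    using assms(2) by (simp add: chart_on_def openin_subset)
  have "snd c ` ?Q = {z \<in> snd c ` fst c. (\<Sum>j<n. (z j)\<^sup>2) \<le> 1}"
    by blast
  also have "\<dots> = {z \<in> coord_space n. (\<Sum>j<n. (z j)\<^sup>2) \<le> 1}"
    by (simp only: assms(3) topspace_Euclidean_space)
  finally have Q: "snd c ` ?Q = {z \<in> coord_space n. (\<Sum>j<n. (z j)\<^sup>2) \<le> 1}" .
  have "compactin (Euclidean_space n) (snd c ` ?Q)"
    unfolding Q Euclidean_space_eq compactin_subtopology using compact_unit_ball by auto
  moreover have "homeomorphic_map (subtopology M (fst c)) (Euclidean_space n) (snd c)"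
    using assms(2,3) by (simp add: chart_on_def)
  moreover have "?Q \<subseteq> topspace (subtopology M (fst c))"
    using \<open>fst c \<subseteq> topspace M\<close> by auto
  ultimately have "compactin (subtopology M (fst c)) ?Q"
    using homeomorphic_map_compactness by blast
  then have "compactin M ?Q"
    by (simp add: compactin_subtopology)
  then show ?thesis
    by (rule compactin_imp_closedin[OF assms(1)])
qed

theorem proposition3p1:
  fixes M :: "'a topology" and A F :: "'a chart set" and p n :: nat and r :: enat
    and K V :: "'a set" and \<phi> :: "'a \<Rightarrow> nat \<Rightarrow> real"
    and U :: "(nat \<Rightarrow> real) set" and y :: "nat \<Rightarrow> nat \<Rightarrow> real"
  assumes "smooth_manifold n M A"
    and "foliation p n r M A F"
    and "closedin M K"
    and "(V, \<phi>) \<in> F" and "\<phi> ` V = topspace (Euclidean_space n)"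
    and "pair_point p (\<lambda>_. 0) (\<lambda>_. 0) \<in> \<phi> ` (V \<inter> K)"
    and "smooth_compact_nbhd p U"
    and "\<forall>x \<in> Euclidean_space p frontier_of U. pair_point p x (\<lambda>_. 0) \<notin> \<phi> ` (V \<inter> K)"
    and "\<forall>i. y i \<in> topspace (Euclidean_space (n - p))"
    and "limitin (Euclidean_space (n - p)) y (\<lambda>_. 0) sequentially"
    and "\<forall>i. \<forall>x \<in> U. pair_point p x (y i) \<notin> \<phi> ` (V \<inter> K)"
  shows "leafwise_cohomology_dim p n r (induced_foliation F (topspace M - K)) p = \<infinity>"
proof -
  let ?X = "topspace M - K"
  define G where "G = induced_foliation F ?X"
  \<comment> \<open>The part of the given chart outside \<open>K\<close>; its image \<open>W\<close>
    is the set O of the overview.\<close>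
  define c where "c = (V \<inter> ?X, \<phi>)"
  define W where "W = \<phi> ` (V \<inter> ?X)"
  have atlas: "foliated_atlas p n r M A F"
    using assms(2) by (simp add: foliation_def)
  then have "p \<le> n"
    by (simp add: foliated_atlas_def)
  have chartF: "chart_on n M d" if "d \<in> F" for d
    using atlas that by (simp add: foliated_atlas_def admissible_chart_def)
  interpret foliated_charts p n r M G
  proof
    show "p \<le> n" by fact
    show "chart_on n M d" if "d \<in> G" for d
      using that chartF by (simp add: G_def induced_foliation_def)
    show "foliated_transition p n r d e" if "d \<in> G" "e \<in> G" for d e
      using that atlas by (simp add: G_def induced_foliation_def foliated_atlas_def)
  qed
  have V: "chart_on n M (V, \<phi>)"
    using chartF[OF assms(4)] .
  have "V \<subseteq> topspace M"
    using V by (simp add: chart_on_def openin_subset)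
  have inj: "inj_on \<phi> V"
    using chart_on_inj[OF V] by simp
  have "openin M ?X"
    using assms(3) by blast
  then have "restrict_chart (V, \<phi>) ?X \<in> F"
    using assms(1) by (intro restrict_chart_in_foliation[OF assms(2) _ assms(4)]) (auto simp: smooth_manifold_def)
  then have c: "c \<in> G"
    by (simp add: G_def induced_foliation_def c_def restrict_chart_def)
  have "openin (Euclidean_space n) W"
    using chart[OF c] by (simp add: chart_on_def c_def W_def)
  have W: "z \<in> W \<longleftrightarrow> z \<notin> \<phi> ` (V \<inter> K)" if "z \<in> coord_space n" for z
  proof -
    have "z \<in> \<phi> ` V"
      using that by (simp add: assms(5) topspace_Euclidean_space)
    moreover have "V \<inter> ?X = V - V \<inter> K"
      using \<open>V \<subseteq> topspace M\<close> by auto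
    then have "W = \<phi> ` V - \<phi> ` (V \<inter> K)"
      using inj_on_image_set_diff[OF inj, of V "V \<inter> K"] by (simp add: W_def)
    ultimately show ?thesis
      by simp
  qed
  have pair: "pair_point p x v \<in> coord_space n" if "v \<in> coord_space (n - p)" for x v
    using that \<open>p \<le> n\<close> by (auto simp: pair_point_def)
  have ycs: "y k \<in> coord_space (n - p)" for k
    using assms(9) by (simp add: topspace_Euclidean_space)

  have zero_pair: "pair_point p (\<lambda>_. 0) (\<lambda>_. 0) = (\<lambda>_. 0)"
    by (auto simp: pair_point_def)

  define S where "S = Euclidean_space p interior_of U"
  define K0 where "K0 = {x \<in> U. pair_point p x (\<lambda>_. 0) \<notin> W}"
  have "compact U" and Ucs: "U \<subseteq> coord_space p" and "(\<lambda>_. 0) \<in> S"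
    using assms(7) by (auto simp: smooth_compact_nbhd_def Euclidean_space_eq compactin_subtopology S_def)
  have S: "openin (Euclidean_space p) S" "S \<subseteq> U"
    by (auto simp: S_def interior_of_subset)
  have "compact K0"
  proof -
    obtain T where T: "open T" "W = coord_space n \<inter> T"
      using \<open>openin (Euclidean_space n) W\<close> by (auto simp: Euclidean_space_eq openin_open)
    have "K0 = U \<inter> (\<lambda>x. pair_point p x (\<lambda>_. 0)) -` (- T)"
      using pair by (auto simp: K0_def T(2))
    moreover have "closed ((\<lambda>x. pair_point p x (\<lambda>_. 0)) -` (- T))"
      using T(1) by (intro closed_vimage continuous_on_pair_point) (auto intro: continuous_intros)
    ultimately show ?thesis
      using \<open>compact U\<close> by (simp add: compact_Int_closed)
  qed
  \<comment> \<open>A point of \<open>U\<close> outside the interior \<open>S\<close> lies on the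
    frontier, where condition (ii) keeps it away from \<open>K\<close>.\<close>
  have "K0 \<subseteq> S"
  proof
    fix x assume "x \<in> K0"
    then have x: "x \<in> U" "pair_point p x (\<lambda>_. 0) \<notin> W"
      by (auto simp: K0_def)
    show "x \<in> S"
    proof (rule ccontr)
      assume "x \<notin> S"
      then have "x \<in> Euclidean_space p frontier_of U"
        using x(1) closure_of_subset[of U "Euclidean_space p"] Ucs
        by (auto simp: frontier_of_def S_def topspace_Euclidean_space)
      then show False
        using assms(8) x(2) W[OF pair] by simp
    qed
  qed
  have "(\<lambda>_. 0) \<in> K0"
    using assms(6) W[OF pair] \<open>(\<lambda>_. 0) \<in> S\<close> S(2) by (auto simp: K0_def)
  then have "K0 \<noteq> {}"
    by blast
  then obtain \<psi> d\<psi> D C where D: "compact D" "D \<subseteq> S" "\<And>x. x \<in> coord_space p - D \<Longrightarrow> \<psi> x = 0"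
    and C: "compact C" "C \<subseteq> D" "C \<inter> K0 = {}" "\<And>x l. x \<in> coord_space p - C \<Longrightarrow> d\<psi> l x = 0"
    and cont: "continuous_on UNIV \<psi>" "\<And>l. continuous_on UNIV (d\<psi> l)"
    and deriv: "\<And>x l. l < p \<Longrightarrow> ((\<lambda>t. \<psi> (x(l := t))) has_real_derivative d\<psi> l x) (at (x l))"
    and \<psi>: "\<And>x. 0 \<le> \<psi> x" "\<And>x. \<psi> x \<le> 1" "\<And>x. x \<in> K0 \<Longrightarrow> \<psi> x = 1"
    by (rule cutoff_function_exists[OF S \<open>compact U\<close> \<open>compact K0\<close> \<open>K0 \<subseteq> S\<close>]) (rule that, assumption+)
  have "D \<subseteq> coord_space p"
    using D(2) S(2) Ucs by blast
  have slices: "\<And>x k. x \<in> S \<Longrightarrow> pair_point p x (y k) \<in> W" "\<And>x. x \<in> C \<Longrightarrow> pair_point p x (\<lambda>_. 0) \<in> W"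
  proof -
    show "pair_point p x (y k) \<in> W" if "x \<in> S" for x k
      using that S(2) assms(11) W[OF pair[OF ycs]] by blast
    show "pair_point p x (\<lambda>_. 0) \<in> W" if "x \<in> C" for x
      using that C(2,3) D(2) S(2) by (auto simp: K0_def)
  qed
  \<comment> \<open>Since \<psi> = 1 at the origin, continuity gives a box around it on which \<psi>
    >= 1 / 2; this is where the poles are felt.\<close>
  have "openin (top_of_set (coord_space p)) {x \<in> coord_space p. 1 / 2 < \<psi> x}"
  proof -
    have "{x \<in> coord_space p. 1 / 2 < \<psi> x} = coord_space p \<inter> \<psi> -` {1 / 2<..}"
      by auto
    moreover have "open (\<psi> -` {1 / 2<..})"
      by (intro open_vimage cont) auto
    ultimately show ?thesis
      by (simp add: openin_open_Int)
  qed
  then obtain e where e: "e > 0"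
    "\<And>x. x \<in> coord_space p \<Longrightarrow> (\<And>j. j < p \<Longrightarrow> \<bar>x j\<bar> < e) \<Longrightarrow> 1 / 2 \<le> \<psi> x"
  proof (rule Euclidean_space_box_nhd[unfolded Euclidean_space_eq])
    show "(\<lambda>_. 0) \<in> {x \<in> coord_space p. 1 / 2 < \<psi> x}"
      using \<psi>(3)[OF \<open>(\<lambda>_. 0) \<in> K0\<close>] by simp
  qed (force intro: that less_imp_le)

  have ylim: "y \<longlonglongrightarrow> (\<lambda>_. 0)"
    using assms(10) by (simp add: Euclidean_space_eq limitin_subtopology)
  define s where "s = (\<lambda>k. \<Sum>j<n - p. (y k j)\<^sup>2)"
  have "s k > 0" for k
  \<comment> \<open>If s_k were 0, then y_k = 0, and condition (iii) at the point 0 of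
    \<open>U\<close> would contradict condition (i).\<close>
  proof (rule ccontr)
    assume "\<not> s k > 0"
    then have "s k = 0"
      by (simp add: s_def sum_nonneg order_antisym)
    then have "y k j = 0" if "j < n - p" for j
      using that unfolding s_def by (subst (asm) sum_nonneg_eq_0_iff) auto
    then have yk: "y k = (\<lambda>_. 0)"
      using ycs[of k] by (auto simp: fun_eq_iff not_le[symmetric])
    have "pair_point p (\<lambda>_. 0) (y k) \<notin> \<phi> ` (V \<inter> K)"
      using assms(11) S(2) \<open>(\<lambda>_. 0) \<in> S\<close> by blast
    then show False
      using assms(6) unfolding yk by simp
  qed
  have "s \<longlonglongrightarrow> (\<Sum>j<n - p. 0\<^sup>2)"
    unfolding s_def
  proof (intro tendsto_sum tendsto_power)
    fix j
    have "continuous_on UNIV (\<lambda>x :: nat \<Rightarrow> real. x j)"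
      by (rule continuous_on_component)
    from continuous_on_tendsto_compose[OF this ylim] show "(\<lambda>k. y k j) \<longlonglongrightarrow> 0"
      by simp
  qed
  then have "s \<longlonglongrightarrow> 0"
    by simp
  have q: "(\<Sum>j<n. (pair_point p x (y k) j)\<^sup>2) = (\<Sum>j<p. (x j)\<^sup>2) + s k" for x k
  proof -
    let ?f = "\<lambda>j. (pair_point p x (y k) j)\<^sup>2"
    have "(\<Sum>j<n. ?f j) = (\<Sum>j<p. ?f j) + (\<Sum>j\<in>{p..<n}. ?f j)"
      using sum.atLeastLessThan_concat[of 0 p n ?f] \<open>p \<le> n\<close> by (simp add: lessThan_atLeast0)
    moreover have "(\<Sum>j\<in>{p..<n}. ?f j) = (\<Sum>j<n - p. ?f (j + p))"
      using sum.shift_bounds_nat_ivl[of ?f 0 p "n - p"] \<open>p \<le> n\<close> by (simp add: lessThan_atLeast0)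
    ultimately have "(\<Sum>j<n. ?f j) = (\<Sum>j<p. ?f j) + (\<Sum>j<n - p. ?f (j + p))"
      by simp
    then show ?thesis
      by (simp add: pair_point_def s_def)
  qed

  let ?\<omega> = "\<lambda>m. top_form p G c (\<lambda>x. pole n m (\<phi> x))"
  have \<omega>: "?\<omega> m \<in> closed_forms p n r G p" for m
    unfolding closed_forms_def
  proof (intro CollectI conjI top_degree_closed top_form_leafwise[OF c])
    let ?Q = "{x \<in> V. (\<Sum>j<n. (\<phi> x j)\<^sup>2) \<le> 1}"
    show "closedin M ?Q"
      using closedin_chart_unit_ball[OF _ V] assms(1,5) by (simp add: smooth_manifold_def)
    show "pole n m (\<phi> x) = 0" if "x \<in> fst c - ?Q" for x
      using that by (intro pole_eq_0) (auto simp: c_def)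
    fix d assume d: "d \<in> G"
    show "fst d \<inter> ?Q \<subseteq> fst c"
      using d by (auto simp: G_def induced_foliation_def c_def)
    have "leafwise_smooth_on p n r (overlap d c) (\<lambda>z. pole n m (transition d c z))"
    proof (rule leafwise_smooth_on_pole[OF openin_overlap[OF chart[OF d] chart[OF c]] \<open>p \<le> n\<close>])
      show "leafwise_smooth_on p n r (overlap d c) (\<lambda>z. transition d c z j)" if "j < n" for j
        by (rule transition_smooth[OF d c that])
      fix z assume "z \<in> overlap d c"
      then obtain x where x: "x \<in> fst d" "x \<in> fst c" "z = snd d x"
        by (auto simp: overlap_def)
      then have z: "transition d c z = \<phi> x"
        using transition_apply[OF chart[OF d] x(1)] by (simp add: c_def)
      have "\<phi> x \<in> coord_space n"
        using x(2) assms(5) by (auto simp: c_def topspace_Euclidean_space)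
      moreover have "\<phi> x \<noteq> (\<lambda>_. 0)"
        using assms(6) x(2) inj unfolding zero_pair by (auto simp: c_def inj_on_def)
      ultimately show "\<exists>j<n. transition d c z j \<noteq> 0"
        unfolding z by (metis (mono_tags, lifting) ext mem_Collect_eq not_le)
    qed
    then show "leafwise_smooth_on p n r (overlap d c) (\<lambda>z. pole n m (\<phi> (chart_inv d z)))"
      by (simp add: transition_def c_def)
  qed
  let ?L = "\<lambda>k \<eta>. \<integral>x. \<psi> (proj p x) * form_coeff p G \<eta> c [0..<p] (pair_point p x (y k)) \<partial>(leaf_measure p)"
  \<comment> \<open>The common core of two arguments: with bound 0 it separates the forms from each
    other, and with the bound for exact forms it gives independence in cohomology.\<close>
  have independent: "a m = 0"
    if bounded: "\<And>k. \<bar>?L k (\<lambda>x vs. \<Sum>m\<in>{p<..N}. a m * ?\<omega> m x vs)\<bar> \<le> B" and m: "m \<in> {p<..N}" for a N B m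
  proof (rule pole_pairing_unbounded[OF D(1) \<open>D \<subseteq> coord_space p\<close> D(3) cont(1) \<psi>(1,2) e
        \<open>\<And>k. s k > 0\<close> \<open>s \<longlonglongrightarrow> 0\<close> _ m, where B = B])
    fix k
    let ?q = "\<lambda>x. (\<Sum>j<p. (x j)\<^sup>2) + s k"
    have integrand: "\<psi> (proj p x) * form_coeff p G (\<lambda>x vs. \<Sum>m\<in>{p<..N}. a m * ?\<omega> m x vs) c [0..<p] (pair_point p x (y k)) =
        \<psi> (proj p x) * (\<Sum>m\<in>{p<..N}. a m * (cutoff 0 (1 - ?q x) * inverse (?q x) ^ m))" for x
    proof (cases "proj p x \<in> S")
      case True
      then have "pair_point p x (y k) \<in> W"
        using slices(1)[OF True, of k] by simp
      then obtain w where w: "w \<in> fst c" "pair_point p x (y k) = snd c w"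
        by (auto simp: W_def c_def)
      have "form_coeff p G (\<lambda>x vs. \<Sum>m\<in>{p<..N}. a m * ?\<omega> m x vs) c [0..<p] (pair_point p x (y k)) =
          (\<Sum>m\<in>{p<..N}. a m * form_coeff p G (?\<omega> m) c [0..<p] (snd c w))"
        by (simp add: form_coeff_def w(2))
      also have "\<dots> = (\<Sum>m\<in>{p<..N}. a m * pole n m (pair_point p x (y k)))"
        unfolding form_coeff_top_form_self[OF c w(1)] w(2) by (simp add: c_def)
      finally show ?thesis
        by (simp only: pole_def q)
    next
      case False
      then have "\<psi> (proj p x) = 0"
        using D(2) by (intro D(3)) auto
      then show ?thesis
        by simp
    qed
    show "\<bar>\<integral>x. \<psi> (proj p x) * (\<Sum>m\<in>{p<..N}. a m * (cutoff 0 (1 - ?q x) *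
        inverse (?q x) ^ m)) \<partial>(leaf_measure p)\<bar> \<le> B"
      using bounded[of k] unfolding integrand .
  qed
  \<comment> \<open>\<open>independent_mod\<close> and the cardinality concern a set of forms, so
    distinct orders must give distinct forms; the coefficients used are 1 at \<open>i\<close> and -1
    at \<open>j\<close>.\<close>
  have inj_\<omega>: "inj_on ?\<omega> {p<..N}" for N
  proof (rule inj_onI, rule ccontr)
    fix i j assume ij: "i \<in> {p<..N}" "j \<in> {p<..N}" "?\<omega> i = ?\<omega> j" "i \<noteq> j"
    let ?a = "\<lambda>l. (if l = i then 1 else 0) - (if l = j then 1 else 0 :: real)"
    have "(\<Sum>l\<in>{p<..N}. ?a l * ?\<omega> l x vs) = ?\<omega> i x vs - ?\<omega> j x vs" for x vs
      using ij(1,2)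
      by (simp add: left_diff_distrib sum_subtractf if_distrib[of "\<lambda>t. t * _"] sum.delta cong: if_cong)
    then have "(\<lambda>x vs. \<Sum>l\<in>{p<..N}. ?a l * ?\<omega> l x vs) = (\<lambda>_ _. 0)"
      using ij(3) by simp
    then have "\<bar>?L k (\<lambda>x vs. \<Sum>l\<in>{p<..N}. ?a l * ?\<omega> l x vs)\<bar> \<le> 0" for k
      by (simp add: form_coeff_def)
    from independent[OF this ij(1)] show False
      using ij(4) by simp
  qed
  have "enat N \<le> leafwise_cohomology_dim p n r G p" for N
  proof -
    \<comment> \<open>Exactly N pole orders, all above the threshold \<open>p\<close>.\<close>
    let ?M = "{p<..p + N}"
    have "independent_mod (exact_forms p n r G p) (?\<omega> ` ?M)"
      unfolding independent_mod_def
    proof (intro allI impI ballI)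
      fix a \<eta>
      assume exact: "(\<lambda>x vs. \<Sum>\<eta>\<in>?\<omega> ` ?M. a \<eta> * \<eta> x vs) \<in> exact_forms p n r G p" and "\<eta> \<in> ?\<omega> ` ?M"
      then obtain m where m: "m \<in> ?M" "\<eta> = ?\<omega> m"
        by blast
      have "(\<lambda>x vs. \<Sum>m\<in>?M. a (?\<omega> m) * ?\<omega> m x vs) \<in> exact_forms p n r G p"
        using exact by (simp add: sum.reindex[OF inj_\<omega>] o_def)
      from exact_pairing_bounded[OF c S(1) D C(1,2,4) cont deriv ylim _ _ this]
      obtain B where "\<And>k. \<bar>?L k (\<lambda>x vs. \<Sum>m\<in>?M. a (?\<omega> m) * ?\<omega> m x vs)\<bar> \<le> B"
        using slices by (auto simp: W_def c_def)
      from independent[OF this m(1)] show "a \<eta> = 0"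
        by (simp add: m(2))
    qed
    moreover have "card (?\<omega> ` ?M) = N"
      by (simp add: card_image[OF inj_\<omega>])
    ultimately show ?thesis
      unfolding leafwise_cohomology_dim_def using \<omega>
      by (intro SUP_upper2[of "?\<omega> ` ?M"]) auto
  qed
  then have "leafwise_cohomology_dim p n r G p = \<infinity>"
    by (metis enat_ord_simps(1) not_infinity_eq Suc_n_not_le_n)
  then show ?thesis
    by (simp add: G_def)
qed

end
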